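(* Fix $(t,B,L,d)$ and consider the model with parameters $(\beta,\mu)$, $\beta,\mu>0$. Then: 1. If $\beta\le\beta_{DW}(t)$, then for any $\mu$ the model with parameters $(\beta,\mu)$ is RS. 2. If $\beta>\beta_{DW}(t)$ and $\mu\ge\mu_{Lar}(\beta;t)$, then the model with parameters $(\beta,\mu)$ is RS.
   Context: $L\ge1$, $d\ge0$ are integers and $t>0$. $\Omega=[[1,L]]^d$ is regarded as a graph with periodic boundary conditions (discrete torus), $|\Omega|=L^d$, and $\Delta$ is its graph Laplacian with the sign convention that $\Delta$ is negative semi-definite. For $A\in\mathbb R^{\Omega\times\Omega}$, $\mathrm{tr}(A)=|\Omega|^{-1}\sum_{x\in\Omega}A_{xx}$. $B(x)=\int_0^\infty e^{-\lambda^2x}\nu(d\lambda)$ for a finite non-negative, non-zero measure $\nu$ on $(0,\infty)$ with $\int_0^\infty e^{\epsilon\lambda^2}\nu(d\lambda)<\infty$ for some $\epsilon>0$ (so $B$ is smooth on $(-\epsilon,\infty)$). For $i\ge1$, $R_i(u;t)=\mathrm{tr}(uI-t\Delta)^{-i}$, $u>0$; $K(\cdot;t):(0,\infty)\to(0,\infty)$ is the functional inverse of $R_1(\cdot;t)$, and $K'$ is its derivative in the first argument. $\mathscr{Y}(q)$ is the set of probability measures on $[0,q]$ whose support does not contain $q$. The Larkin equation at inverse temperature $\beta$ is the equation in $\mu>0$ $$4B''\left(\frac2\beta R_1(\mu;t)\right)R_2(\mu;t)=1.$$ $\beta_{DW}(t)\ge0$ is the threshold such that this equation has a solution $\mu$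 for $\beta\geq\beta_{DW}(t)$ and none for $\beta<\beta_{DW}(t)$, i.e. $\beta_{DW}(t)=\inf\{\beta>0:\text{the Larkin equation has a solution }\mu>0\}$. For $\beta\ge\beta_{DW}(t)$, the Larkin mass $\mu_{Lar}(\beta;t)$ is the largest $\mu$ solving the Larkin equation. For given $(\beta,\mu)$, the pair $(q_c,\zeta_c)$ is the unique pair $(q,\zeta)$ with $q\in(0,\infty)$, $\zeta\in\mathscr{Y}(q)$ such that, with $\delta(s)=\int_s^q\zeta([0,u])du$, $F_{\beta,q}(s)=-2B'(2(q-s))+\int_0^sK'(\beta\delta(u);t)du$ and $f_{\beta,q}(s)=\int_0^sF_{\beta,q}(u)du$ for $s\in(0,q)$ (extended to $[0,q]$ by its limits $f_{\beta,q}(0)=0$, $f_{\beta,q}(q)=-\infty$), $$\beta\int_0^q\zeta([0,u])du=R_1(\mu;t),\qquad \zeta\Big(\big\{s\in[0,q]:f_{\beta,q}(s)=\sup_{0<s'<q}f_{\beta,q}(s')\big\}\Big)=1.$$ ($\zeta_c$ is the Parisi measure of the elastic manifold model at inverse temperature $\beta$ and mass $\mu$.) The model is replica symmetric (RS) if $\zeta_c$ is a Dirac mass. *)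

theory Defs
  imports
    "HOL-Probability.Probability"
    "Jordan_Normal_Form.Gauss_Jordan_Elimination"
begin

subsection \<open>The discrete torus and its Laplacian\<close>

text \<open>The sites of the box are the lists of length \<open>d\<close> with entries in \<open>{1..L}\<close>; a matrix indexed
  by the box is an \<open>L ^ d\<close> by \<open>L ^ d\<close> matrix through the enumeration \<^term>\<open>torus_sites L d\<close>.\<close>

definition torus_sites :: "nat \<Rightarrow> nat \<Rightarrow> nat list list" where
  "torus_sites L d = List.n_lists d [1..<Suc L]"

text \<open>The torus is a simple graph: there are no loops if \<open>L = 1\<close> and no double edges if \<open>L = 2\<close>.
  (Double edges would only replace the Laplacian by twice itself.)\<close>

definition torus_adj :: "nat \<Rightarrow> nat \<Rightarrow> nat list \<Rightarrow> nat list \<Rightarrow> bool" where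
  "torus_adj L d x y \<longleftrightarrow> x \<noteq> y \<and>
     (\<exists>i<d. (\<forall>j<d. j \<noteq> i \<longrightarrow> x ! j = y ! j) \<and>
            (y ! i mod L = (x ! i + 1) mod L \<or> x ! i mod L = (y ! i + 1) mod L))"

definition torus_laplacian :: "nat \<Rightarrow> nat \<Rightarrow> real mat" where
  "torus_laplacian L d = Matrix.mat (L ^ d) (L ^ d) (\<lambda>(j, k).
     let x = torus_sites L d ! j; y = torus_sites L d ! k in
     if x = y then - real (card {z \<in> set (torus_sites L d). torus_adj L d x z})
     else if torus_adj L d x y then 1 else 0)"

definition normalized_trace :: "real mat \<Rightarrow> real" where
  "normalized_trace A = (\<Sum>j<dim_row A. A $$ (j, j)) / real (dim_row A)"

definition R_fun :: "nat \<Rightarrow> nat \<Rightarrow> real \<Rightarrow> nat \<Rightarrow> real \<Rightarrow> real" where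
  "R_fun L d t i u = normalized_trace
     (the (mat_inverse (u \<cdot>\<^sub>m 1\<^sub>m (L ^ d) - t \<cdot>\<^sub>m torus_laplacian L d)) ^\<^sub>m i)"

definition K_fun :: "nat \<Rightarrow> nat \<Rightarrow> real \<Rightarrow> real \<Rightarrow> real" where
  "K_fun L d t = the_inv_into {0<..} (R_fun L d t 1)"

subsection \<open>The correlation function\<close>

text \<open>A measure on \<open>(0, \<infinity>)\<close> is encoded as a Borel measure on the reals giving no mass to the
  complement. Finiteness of the exponential moment is stated as integrability.\<close>

definition correlator :: "(real \<Rightarrow> real) \<Rightarrow> bool" where
  "correlator B \<longleftrightarrow> (\<exists>\<nu> :: real measure. \<exists>\<epsilon>>0.
     sets \<nu> = sets borel \<and> finite_measure \<nu> \<and> emeasure \<nu> {..0} = 0 \<and> emeasure \<nu> {0<..} \<noteq> 0 \<and>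
     integrable \<nu> (\<lambda>l. exp (\<epsilon> * l\<^sup>2)) \<and>
     (\<forall>x>-\<epsilon>. B x = (LINT l|\<nu>. exp (- (l\<^sup>2 * x)))))"

subsection \<open>The Larkin equation\<close>

definition larkin_eq :: "nat \<Rightarrow> nat \<Rightarrow> (real \<Rightarrow> real) \<Rightarrow> real \<Rightarrow> real \<Rightarrow> real \<Rightarrow> bool" where
  "larkin_eq L d B t \<beta> \<mu> \<longleftrightarrow>
     4 * deriv (deriv B) (2 / \<beta> * R_fun L d t 1 \<mu>) * R_fun L d t 2 \<mu> = 1"

definition beta_DW :: "nat \<Rightarrow> nat \<Rightarrow> (real \<Rightarrow> real) \<Rightarrow> real \<Rightarrow> real" where
  "beta_DW L d B t = Inf {\<beta>. \<beta> > 0 \<and> (\<exists>\<mu>>0. larkin_eq L d B t \<beta> \<mu>)}"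

definition mu_Lar :: "nat \<Rightarrow> nat \<Rightarrow> (real \<Rightarrow> real) \<Rightarrow> real \<Rightarrow> real \<Rightarrow> real" where
  "mu_Lar L d B t \<beta> = (GREATEST \<mu>. \<mu> > 0 \<and> larkin_eq L d B t \<beta> \<mu>)"

subsection \<open>The Parisi measure\<close>

definition measure_support :: "real measure \<Rightarrow> real set" where
  "measure_support M = {x. \<forall>U. open U \<and> x \<in> U \<longrightarrow> emeasure M U \<noteq> 0}"

text \<open>Probability measures on \<open>[0, q]\<close> are Borel probability measures on the reals giving full mass
  to \<open>[0, q]\<close>.\<close>

definition Y_set :: "real \<Rightarrow> real measure set" where
  "Y_set q = {\<zeta>. sets \<zeta> = sets borel \<and> prob_space \<zeta> \<and> measure \<zeta> {0..q} = 1 \<and> q \<notin> measure_support \<zeta>}"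

definition delta :: "real \<Rightarrow> real measure \<Rightarrow> real \<Rightarrow> real" where
  "delta q \<zeta> s = integral {s..q} (\<lambda>u. measure \<zeta> {0..u})"

definition F_fun :: "nat \<Rightarrow> nat \<Rightarrow> (real \<Rightarrow> real) \<Rightarrow> real \<Rightarrow> real \<Rightarrow> real \<Rightarrow> real measure \<Rightarrow> real \<Rightarrow> real" where
  "F_fun L d B t \<beta> q \<zeta> s =
     -2 * deriv B (2 * (q - s)) + integral {0..s} (\<lambda>u. deriv (K_fun L d t) (\<beta> * delta q \<zeta> u))"

definition f_fun :: "nat \<Rightarrow> nat \<Rightarrow> (real \<Rightarrow> real) \<Rightarrow> real \<Rightarrow> real \<Rightarrow> real \<Rightarrow> real measure \<Rightarrow> real \<Rightarrow> ereal" where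
  "f_fun L d B t \<beta> q \<zeta> s = (if s = q then -\<infinity> else ereal (integral {0..s} (F_fun L d B t \<beta> q \<zeta>)))"

definition parisi_pair ::
  "nat \<Rightarrow> nat \<Rightarrow> (real \<Rightarrow> real) \<Rightarrow> real \<Rightarrow> real \<Rightarrow> real \<Rightarrow> real \<times> real measure \<Rightarrow> bool" where
  "parisi_pair L d B t \<beta> \<mu> = (\<lambda>(q, \<zeta>). q > 0 \<and> \<zeta> \<in> Y_set q \<and>
     \<beta> * integral {0..q} (\<lambda>u. measure \<zeta> {0..u}) = R_fun L d t 1 \<mu> \<and>
     measure \<zeta> {s \<in> {0..q}. f_fun L d B t \<beta> q \<zeta> s = (SUP s'\<in>{0<..<q}. f_fun L d B t \<beta> q \<zeta> s')} = 1)"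

definition parisi_measure ::
  "nat \<Rightarrow> nat \<Rightarrow> (real \<Rightarrow> real) \<Rightarrow> real \<Rightarrow> real \<Rightarrow> real \<Rightarrow> real measure" where
  "parisi_measure L d B t \<beta> \<mu> = snd (THE p. parisi_pair L d B t \<beta> \<mu> p)"

definition replica_symmetric ::
  "nat \<Rightarrow> nat \<Rightarrow> (real \<Rightarrow> real) \<Rightarrow> real \<Rightarrow> real \<Rightarrow> real \<Rightarrow> bool" where
  "replica_symmetric L d B t \<beta> \<mu> \<longleftrightarrow> (\<exists>a. parisi_measure L d B t \<beta> \<mu> = return borel a)"

end

theory Submission
  imports Defs "Jordan_Normal_Form.Determinant"
begin

text \<open>For any Parisi pair \<open>(q, \<zeta>)\<close> the function \<open>F\<close> has slope
  \<open>4 B''(2(q - s)) + K'(\<beta> \<delta>(s))\<close>. Since \<open>\<delta>(s) \<le> q - s\<close> and \<open>B''\<close> is decreasing, with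
  \<open>v = K(\<beta> \<delta>(s)) \<ge> \<mu>\<close> this is at most \<open>4 B''(2 R\<^sub>1(v) / \<beta>) - 1 / R\<^sub>2(v)\<close>, which is nonpositive
  as soon as the left-hand side of the Larkin equation stays below \<open>1\<close> on \<open>[\<mu>, \<infinity>)\<close>; this holds in
  both regimes of the theorem. So \<open>f\<close> is concave, and strictly so below the supremum of the support
  of \<open>\<zeta>\<close>. Hence \<open>\<zeta>\<close> is a Dirac mass at a zero \<open>a\<close> of \<open>F\<close>, and \<open>F(a) = 0\<close> together with
  \<open>\<beta> (q - a) = R\<^sub>1(\<mu>)\<close> determines \<open>a\<close> and \<open>q\<close>. Conversely, concavity of \<open>f\<close> shows that these
  values define a Parisi pair. No diagonalization of the Laplacian is needed: \<open>R\<^sub>1' = - R\<^sub>2\<close>,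
  positivity and decay follow from the resolvent identity and positive definiteness.\<close>

subsection \<open>The torus Laplacian and its resolvent\<close>

lemma torus_sites_nth_eq_iff: "(torus_sites L d ! j = torus_sites L d ! k) = (j = k)"
  if "j < L ^ d" "k < L ^ d"
  using that unfolding torus_sites_def
  by (simp add: nth_eq_iff_index_eq distinct_n_lists length_n_lists del: upt_Suc)

lemma torus_adj_commute: "torus_adj L d x y = torus_adj L d y x"
  unfolding torus_adj_def by metis

definition torus_weight :: "nat \<Rightarrow> nat \<Rightarrow> nat \<Rightarrow> nat \<Rightarrow> real" where
  "torus_weight L d j k = (if torus_adj L d (torus_sites L d ! j) (torus_sites L d ! k) then 1 else 0)"

lemma torus_weight_commute: "torus_weight L d j k = torus_weight L d k j"
  by (simp add: torus_weight_def torus_adj_commute)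

lemma torus_degree:
  "real (card {z \<in> set (torus_sites L d). torus_adj L d (torus_sites L d ! j) z}) = (\<Sum>k<L ^ d. torus_weight L d j k)"
proof -
  let ?S = "torus_sites L d" and ?a = "torus_adj L d (torus_sites L d ! j)"
  have len: "length ?S = L ^ d" and dist: "distinct ?S"
    by (simp_all add: torus_sites_def length_n_lists distinct_n_lists del: upt_Suc)
  have "(\<Sum>k<L ^ d. torus_weight L d j k) = (\<Sum>z\<in>set ?S. if ?a z then 1 else 0)"
    using sum.reindex_bij_betw[OF bij_betw_nth[OF dist refl refl], of "\<lambda>z. if ?a z then 1 else (0::real)"]
    by (simp add: len torus_weight_def)
  also have "\<dots> = real (card {z \<in> set ?S. ?a z})"
    by (simp add: sum.If_cases Int_def)
  finally show ?thesis by simp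
qed

text \<open>The single formula also covers the diagonal: a site is never adjacent to itself, so its
  own weight is zero there.\<close>

lemma torus_laplacian_index:
  assumes "j < L ^ d" "k < L ^ d"
  shows "torus_laplacian L d $$ (j, k) =
    torus_weight L d j k - (if j = k then \<Sum>i<L ^ d. torus_weight L d j i else 0)"
  using assms
  by (simp add: torus_laplacian_def Let_def torus_sites_nth_eq_iff torus_degree)
     (auto simp: torus_weight_def torus_adj_def)

lemma torus_laplacian_carrier [simp]: "torus_laplacian L d \<in> carrier_mat (L ^ d) (L ^ d)"
  by (simp add: torus_laplacian_def)

lemma torus_laplacian_sym:
  assumes "j < L ^ d" "k < L ^ d"
  shows "torus_laplacian L d $$ (j, k) = torus_laplacian L d $$ (k, j)"
  using assms by (simp add: torus_laplacian_index torus_weight_commute)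

text \<open>Minus the form is half the Dirichlet energy, the sum of
  \<open>?w j k * (x j - x k)\<^sup>2\<close>; symmetry of the weights makes the two square terms in
  its expansion equal.\<close>

lemma torus_laplacian_form_nonpos:
  "(\<Sum>j<L ^ d. \<Sum>k<L ^ d. torus_laplacian L d $$ (j, k) * x j * x k) \<le> 0"
proof -
  let ?w = "torus_weight L d" and ?n = "L ^ d"
  let ?A = "\<Sum>j<?n. \<Sum>k<?n. ?w j k * x j * x k"
  let ?B = "\<Sum>j<?n. \<Sum>k<?n. ?w j k * (x j)\<^sup>2"
  have "(\<Sum>j<?n. \<Sum>k<?n. torus_laplacian L d $$ (j, k) * x j * x k) =
    (\<Sum>j<?n. \<Sum>k<?n. ?w j k * x j * x k - (if j = k then (\<Sum>i<?n. ?w j i) * x j * x j else 0))"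
    by (intro sum.cong refl) (auto simp: torus_laplacian_index algebra_simps)
  also have "\<dots> = ?A - ?B"
    by (simp add: sum_subtractf sum_distrib_right power2_eq_square mult.assoc)
  finally have eq: "(\<Sum>j<?n. \<Sum>k<?n. torus_laplacian L d $$ (j, k) * x j * x k) = ?A - ?B" .
  have B': "(\<Sum>j<?n. \<Sum>k<?n. ?w j k * (x k)\<^sup>2) = ?B"
    by (subst sum.swap) (simp add: torus_weight_commute)
  have "0 \<le> (\<Sum>j<?n. \<Sum>k<?n. ?w j k * (x j - x k)\<^sup>2)"
    by (intro sum_nonneg mult_nonneg_nonneg) (auto simp: torus_weight_def)
  also have "\<dots> = ?B + (\<Sum>j<?n. \<Sum>k<?n. ?w j k * (x k)\<^sup>2) - 2 * ?A"
    by (simp add: power2_eq_square algebra_simps sum.distrib sum_subtractf sum_distrib_left)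
  finally show ?thesis unfolding eq B' by simp
qed

section \<open>Resolvents of symmetric negative semidefinite matrices\<close>

locale dissipative_matrix =
  fixes n :: nat and A :: "real mat"
  assumes n_pos: "n > 0"
    and carrier: "A \<in> carrier_mat n n"
    and sym: "\<And>j k. j < n \<Longrightarrow> k < n \<Longrightarrow> A $$ (j, k) = A $$ (k, j)"
    and form_nonpos: "\<And>x. (\<Sum>j<n. \<Sum>k<n. A $$ (j, k) * x j * x k) \<le> 0"
begin

definition M :: "real \<Rightarrow> real mat" where "M u = u \<cdot>\<^sub>m 1\<^sub>m n - A"

definition G :: "real \<Rightarrow> real mat" where "G u = the (mat_inverse (M u))"

definition g :: "real \<Rightarrow> nat \<Rightarrow> nat \<Rightarrow> real" where "g u j k = G u $$ (j, k)"

lemma M_carrier [simp]: "M u \<in> carrier_mat n n"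
  using carrier by (simp add: M_def minus_carrier_mat)

text \<open>Coercivity of \<open>M u\<close>, obtained by dropping the non-positive form of
  \<open>A\<close>. Invertibility and the bounds on the resolvent rest on it.\<close>

lemma M_form: "u * (\<Sum>j<n. (x j)\<^sup>2) \<le> (\<Sum>j<n. x j * (\<Sum>k<n. M u $$ (j, k) * x k))"
proof -
  have "(\<Sum>j<n. x j * (\<Sum>k<n. M u $$ (j, k) * x k)) =
     (\<Sum>j<n. \<Sum>k<n. (if j = k then u * x j * x j else 0) - A $$ (j, k) * x j * x k)"
    using carrier unfolding sum_distrib_left
    by (intro sum.cong refl) (auto simp: M_def algebra_simps)
  also have "\<dots> = u * (\<Sum>j<n. (x j)\<^sup>2) - (\<Sum>j<n. \<Sum>k<n. A $$ (j, k) * x j * x k)"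
    by (simp add: sum_subtractf power2_eq_square sum_distrib_left mult.assoc)
  finally show ?thesis using form_nonpos[of x] by simp
qed

text \<open>By coercivity a kernel vector of \<open>M u\<close> vanishes, so the determinant is
  nonzero and \<open>mat_inverse\<close> returns \<open>Some\<close>. Only then is
  \<open>the\<close> in \<open>G\<close> meaningful.\<close>

lemma G_inverse:
  assumes "u > 0"
  shows "M u * G u = 1\<^sub>m n" "G u * M u = 1\<^sub>m n" "G u \<in> carrier_mat n n"
proof -
  have "Determinant.det (M u) \<noteq> 0"
  proof
    assume "Determinant.det (M u) = 0"
    then obtain v where v: "v \<in> carrier_vec n" "v \<noteq> 0\<^sub>v n" "M u *\<^sub>v v = 0\<^sub>v n"
      using det_0_iff_vec_prod_zero_field[OF M_carrier] by blast
    have "(\<Sum>k<n. M u $$ (j, k) * vec_index v k) = 0" if "j < n" for j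
    proof -
      have "vec_index (M u *\<^sub>v v) j = 0" using v that by simp
      then show ?thesis using that v(1) M_carrier[of u]
        by (simp add: scalar_prod_def atLeast0LessThan)
    qed
    then have "u * (\<Sum>j<n. (vec_index v j)\<^sup>2) \<le> 0"
      using M_form[of u "vec_index v"] by simp
    then have "(\<Sum>j<n. (vec_index v j)\<^sup>2) \<le> 0"
      using assms by (simp add: mult_le_0_iff)
    then have "(\<Sum>j<n. (vec_index v j)\<^sup>2) = 0"
      by (simp add: antisym sum_nonneg)
    then have "\<forall>j<n. vec_index v j = 0"
      by (simp add: sum_nonneg_eq_0_iff)
    then have "v = 0\<^sub>v n" using v(1) by (intro eq_vecI) auto
    with v(2) show False by simp
  qed
  then have "M u \<in> Units (ring_mat TYPE(real) n ())"
    by (rule det_non_zero_imp_unit[OF M_carrier])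
  then obtain C where "mat_inverse (M u) = Some C"
    using mat_inverse(1)[OF M_carrier] by fastforce
  then show "M u * G u = 1\<^sub>m n" "G u * M u = 1\<^sub>m n" "G u \<in> carrier_mat n n"
    using mat_inverse(2)[OF M_carrier] by (auto simp: G_def)
qed

lemma sum_M_g:
  assumes "u > 0" "j < n" "k < n"
  shows "(\<Sum>i<n. M u $$ (j, i) * g u i k) = (if j = k then 1 else 0)"
proof -
  have "(M u * G u) $$ (j, k) = (1\<^sub>m n :: real mat) $$ (j, k)"
    using G_inverse[OF assms(1)] by simp
  then show ?thesis
    using G_inverse(3)[OF assms(1)] M_carrier[of u] assms(2,3)
    by (simp add: scalar_prod_def g_def atLeast0LessThan)
qed

lemma M_sym: "j < n \<Longrightarrow> k < n \<Longrightarrow> M u $$ (j, k) = M u $$ (k, j)"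
  using sym[of j k] carrier by (simp add: M_def)

text \<open>The product of transposed \<open>G u\<close>, \<open>M u\<close> and \<open>G u\<close>
  is symmetric because \<open>M u\<close> is; by \<open>*\<close> its entries are those of
  \<open>G u\<close> transposed.\<close>

lemma g_sym:
  assumes "u > 0" "j < n" "k < n"
  shows "g u j k = g u k j"
proof -
  have *: "(\<Sum>i<n. \<Sum>l<n. g u i a * M u $$ (i, l) * g u l b) = g u b a"
    if "a < n" "b < n" for a b
  proof -
    have "(\<Sum>i<n. \<Sum>l<n. g u i a * M u $$ (i, l) * g u l b) = (\<Sum>i<n. g u i a * (if i = b then 1 else 0))"
      using sum_M_g[OF assms(1) _ that(2)]
      by (intro sum.cong refl) (simp add: mult.assoc flip: sum_distrib_left)
    also have "\<dots> = g u b a" using that by (simp add: if_distrib[of "times _"] cong: if_cong)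
    finally show ?thesis .
  qed
  have "g u j k = (\<Sum>i<n. \<Sum>l<n. g u i k * M u $$ (i, l) * g u l j)" using *[of k j] assms by simp
  also have "\<dots> = (\<Sum>l<n. \<Sum>i<n. g u i k * M u $$ (i, l) * g u l j)" by (rule sum.swap)
  also have "\<dots> = (\<Sum>l<n. \<Sum>i<n. g u l j * M u $$ (l, i) * g u i k)"
    by (intro sum.cong refl) (simp add: M_sym mult_ac)
  also have "\<dots> = g u k j" using *[of j k] assms by simp
  finally show ?thesis .
qed

text \<open>Coercivity is tested on column \<open>k\<close> of \<open>G u\<close>, which
  \<open>M u\<close> maps to the \<open>k\<close>-th unit vector.\<close>

lemma sum_g_sq_le:
  assumes "u > 0" "k < n"
  shows "u * (\<Sum>j<n. (g u j k)\<^sup>2) \<le> g u k k"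
proof -
  have "u * (\<Sum>j<n. (g u j k)\<^sup>2) \<le> (\<Sum>j<n. g u j k * (\<Sum>i<n. M u $$ (j, i) * g u i k))"
    by (rule M_form)
  also have "\<dots> = (\<Sum>j<n. g u j k * (if j = k then 1 else 0))"
    using sum_M_g[OF assms(1) _ assms(2)] by (intro sum.cong refl) simp
  also have "\<dots> = g u k k" using assms by (simp add: if_distrib[of "times _"] cong: if_cong)
  finally show ?thesis .
qed

lemma g_diag_pos:
  assumes "u > 0" "k < n"
  shows "g u k k > 0"
proof -
  have "\<exists>j<n. g u j k \<noteq> 0"
  proof (rule ccontr)
    assume "\<not> ?thesis"
    then have "(\<Sum>i<n. M u $$ (k, i) * g u i k) = 0" by simp
    then show False using sum_M_g[OF assms(1,2,2)] by simp
  qed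
  then have "(\<Sum>j<n. (g u j k)\<^sup>2) > 0"
    by (auto intro!: sum_pos2)
  then have "u * (\<Sum>j<n. (g u j k)\<^sup>2) > 0" using assms(1) by simp
  then show ?thesis using sum_g_sq_le[OF assms] by linarith
qed

lemma g_diag_le:
  assumes "u > 0" "k < n"
  shows "g u k k \<le> 1 / u"
proof -
  have "(g u k k)\<^sup>2 \<le> (\<Sum>j<n. (g u j k)\<^sup>2)"
    using assms(2) by (intro member_le_sum) auto
  then have "u * (g u k k)\<^sup>2 \<le> g u k k"
    using sum_g_sq_le[OF assms] assms(1) by (meson mult_left_mono order.trans less_imp_le)
  then have "(u * g u k k) * g u k k \<le> 1 * g u k k" by (simp add: power2_eq_square mult.assoc)
  then have "u * g u k k \<le> 1" using g_diag_pos[OF assms] by simp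
  then show ?thesis using assms(1) by (simp add: field_simps)
qed

lemma abs_g_le:
  assumes "u > 0" "j < n" "k < n"
  shows "\<bar>g u j k\<bar> \<le> 1 / u"
proof -
  have "(g u j k)\<^sup>2 \<le> (\<Sum>j<n. (g u j k)\<^sup>2)"
    using assms(2) by (intro member_le_sum) auto
  also have "\<dots> \<le> g u k k / u"
    using sum_g_sq_le[OF assms(1,3)] assms(1) by (simp add: field_simps)
  also have "\<dots> \<le> (1 / u) / u"
    using g_diag_le[OF assms(1,3)] assms(1) by (intro divide_right_mono) auto
  finally have "\<bar>g u j k\<bar>\<^sup>2 \<le> (1 / u)\<^sup>2" by (simp add: power2_eq_square)
  then show ?thesis using assms(1) by (metis divide_nonneg_pos power2_le_imp_le zero_le_one)
qed

text \<open>Insert \<open>M v * G v = 1\<^sub>m n\<close> to the right of \<open>G u\<close> and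
  expand \<open>M v\<close> as \<open>M u\<close> plus \<open>v - u\<close> times the
  identity.\<close>

lemma resolvent_identity:
  assumes "u > 0" "v > 0" "j < n" "k < n"
  shows "g u j k - g v j k = (v - u) * (\<Sum>i<n. g u j i * g v i k)"
proof -
  note G = G_inverse(3)[OF assms(1)] G_inverse(3)[OF assms(2)]
  have Mv: "M v = M u + (v - u) \<cdot>\<^sub>m 1\<^sub>m n"
    using carrier by (intro eq_matI) (auto simp: M_def algebra_simps)
  have "G u = G u * (M v * G v)"
    using G_inverse[OF assms(1)] G_inverse[OF assms(2)] by simp
  also have "\<dots> = (G u * M v) * G v"
    using G by (simp add: assoc_mult_mat[of _ n n _ n _ n])
  also have "G u * M v = 1\<^sub>m n + (v - u) \<cdot>\<^sub>m G u"
    unfolding Mv using G G_inverse(2)[OF assms(1)]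
    by (simp add: mult_add_distrib_mat[of _ n n _ n] mult_smult_distrib[of _ n n _ n])
  also have "\<dots> * G v = G v + (v - u) \<cdot>\<^sub>m (G u * G v)"
    using G by (simp add: add_mult_distrib_mat[of _ n n _ _ n] mult_smult_assoc_mat[of _ n n _ n])
  finally have "G u $$ (j, k) = (G v + (v - u) \<cdot>\<^sub>m (G u * G v)) $$ (j, k)" by simp
  then show ?thesis
    using G assms(3,4) by (simp add: g_def scalar_prod_def atLeast0LessThan)
qed

lemma isCont_g:
  assumes "v > 0" "j < n" "k < n"
  shows "isCont (\<lambda>u. g u j k) v"
proof -
  \<comment> \<open>For \<open>u > v / 2\<close> the entries of \<open>G u\<close> are bounded by
    \<open>2 / v\<close>, uniformly in \<open>u\<close>.\<close>
  have "\<forall>\<^sub>F u in at v. v / 2 < u"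
    using assms(1) by (intro order_tendstoD(1)[of "\<lambda>x. x" v]) auto
  then have "\<forall>\<^sub>F u in at v. norm (g u j k - g v j k) \<le> \<bar>v - u\<bar> * (n * (2 / v * (1 / v)))"
  proof eventually_elim
    case (elim u)
    then have u: "u > 0" using assms(1) by linarith
    have "\<bar>\<Sum>i<n. g u j i * g v i k\<bar> \<le> (\<Sum>i<n. \<bar>g u j i * g v i k\<bar>)" by (rule sum_abs)
    also have "\<dots> \<le> (\<Sum>i<n. 2 / v * (1 / v))"
    proof (intro sum_mono)
      fix i assume "i \<in> {..<n}"
      then have "\<bar>g u j i\<bar> \<le> 1 / u" "\<bar>g v i k\<bar> \<le> 1 / v" using abs_g_le u assms by auto
      moreover have "1 / u \<le> 2 / v" using elim u assms(1) by (simp add: field_simps)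
      ultimately show "\<bar>g u j i * g v i k\<bar> \<le> 2 / v * (1 / v)"
        unfolding abs_mult using assms(1) by (intro mult_mono) auto
    qed
    finally show ?case
      unfolding resolvent_identity[OF u assms] real_norm_def abs_mult
      by (intro mult_left_mono) auto
  qed
  moreover have "((\<lambda>u. \<bar>v - u\<bar> * (n * (2 / v * (1 / v)))) \<longlongrightarrow> 0) (at v)"
    by (intro tendsto_mult_left_zero tendsto_rabs_zero) (auto intro!: tendsto_eq_intros)
  ultimately have "((\<lambda>u. g u j k - g v j k) \<longlongrightarrow> 0) (at v)"
    by (rule Lim_null_comparison)
  then show ?thesis unfolding isCont_def by (rule LIM_zero_cancel)
qed

definition r1 :: "real \<Rightarrow> real" where "r1 u = (\<Sum>j<n. g u j j) / n"

definition r2 :: "real \<Rightarrow> real" where "r2 u = (\<Sum>j<n. \<Sum>k<n. g u j k * g u k j) / n"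

lemma normalized_trace_G:
  assumes "u > 0"
  shows "normalized_trace (G u ^\<^sub>m 1) = r1 u" "normalized_trace (G u ^\<^sub>m 2) = r2 u"
proof -
  have G: "G u \<in> carrier_mat n n" "dim_row (G u) = n" "dim_col (G u) = n"
    using G_inverse(3)[OF assms] by auto
  show "normalized_trace (G u ^\<^sub>m 1) = r1 u"
    using G by (simp add: normalized_trace_def r1_def g_def)
  have "G u ^\<^sub>m 2 = G u * G u" using G by (simp add: numeral_2_eq_2)
  then show "normalized_trace (G u ^\<^sub>m 2) = r2 u"
    using G by (simp add: normalized_trace_def r2_def g_def scalar_prod_def atLeast0LessThan)
qed

lemma r1_pos: "u > 0 \<Longrightarrow> r1 u > 0"
  using n_pos g_diag_pos by (auto simp: r1_def intro!: divide_pos_pos sum_pos)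

lemma r1_le: "u > 0 \<Longrightarrow> r1 u \<le> 1 / u"
  using n_pos sum_bounded_above[of "{..<n}" "\<lambda>j. g u j j" "1 / u"] g_diag_le
  by (auto simp: r1_def field_simps)

text \<open>By symmetry of \<open>g\<close> the trace of the squared resolvent is a sum of squares
  that contains the positive squares of the diagonal entries.\<close>

lemma r2_pos:
  assumes "u > 0"
  shows "r2 u > 0"
proof -
  have "(\<Sum>k<n. g u j k * g u k j) > 0" if "j < n" for j
  proof (rule sum_pos2[of _ j])
    show "0 \<le> g u j k * g u k j" if "k \<in> {..<n}" for k
      using g_sym[OF assms, of j k] that \<open>j < n\<close> by simp
    show "g u j j * g u j j > 0" using g_diag_pos[OF assms that] by simp
  qed (use that in auto)
  then have "(\<Sum>j<n. \<Sum>k<n. g u j k * g u k j) > 0"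
    using n_pos by (intro sum_pos[of "{..<n}" "\<lambda>j. \<Sum>k<n. g u j k * g u k j"]) auto
  then show ?thesis using n_pos by (simp add: r2_def)
qed

text \<open>A crude bound: the factor \<open>n\<close> is harmless, since the estimate serves only
  to show decay at infinity.\<close>

lemma r2_le:
  assumes "u > 0"
  shows "r2 u \<le> 1 / u\<^sup>2 * n"
proof -
  have "(\<Sum>j<n. \<Sum>k<n. g u j k * g u k j) \<le> (\<Sum>j<n. \<Sum>k<n. 1 / u\<^sup>2)"
  proof (intro sum_mono)
    fix j k assume "j \<in> {..<n}" "k \<in> {..<n}"
    then have "\<bar>g u j k\<bar> \<le> 1 / u" "\<bar>g u k j\<bar> \<le> 1 / u" using abs_g_le assms by auto
    then have "\<bar>g u j k\<bar> * \<bar>g u k j\<bar> \<le> (1 / u) * (1 / u)" using assms by (intro mult_mono) auto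
    then show "g u j k * g u k j \<le> 1 / u\<^sup>2"
      by (simp add: power2_eq_square flip: abs_mult)
  qed
  then show ?thesis using n_pos by (simp add: r2_def field_simps)
qed

lemma isCont_r2: "u > 0 \<Longrightarrow> isCont r2 u"
  unfolding r2_def using n_pos isCont_g by (intro continuous_intros) auto

text \<open>By the resolvent identity the difference quotient is minus the normalized trace of
  \<open>G u * G v\<close>; its limit follows from continuity of the entries.\<close>

lemma r1_has_derivative:
  assumes "v > 0"
  shows "(r1 has_real_derivative - r2 v) (at v)"
proof -
  have "((\<lambda>u. - ((\<Sum>j<n. \<Sum>k<n. g u j k * g v k j) / n)) \<longlongrightarrow> - ((\<Sum>j<n. \<Sum>k<n. g v j k * g v k j) / n)) (at v)"
    using n_pos assms isCont_g[unfolded isCont_def] by (intro tendsto_intros) auto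
  moreover have "\<forall>\<^sub>F u in at v. 0 < u"
    using assms by (intro order_tendstoD(1)[of "\<lambda>x. x" v]) auto
  then have "\<forall>\<^sub>F u in at v. - ((\<Sum>j<n. \<Sum>k<n. g u j k * g v k j) / n) = (r1 u - r1 v) / (u - v)"
    using eventually_neq_at_within[of v v UNIV]
  proof eventually_elim
    case (elim u)
    define s where "s = (\<Sum>j<n. \<Sum>k<n. g u j k * g v k j) / n"
    have "r1 u - r1 v = (\<Sum>j<n. g u j j - g v j j) / n"
      by (simp add: r1_def sum_subtractf diff_divide_distrib)
    also have "\<dots> = (\<Sum>j<n. (v - u) * (\<Sum>k<n. g u j k * g v k j)) / n"
      using resolvent_identity[OF elim(1) assms] by simp
    also have "\<dots> = (v - u) * s"
      by (simp add: s_def flip: sum_distrib_left)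
    finally have "r1 u - r1 v = (v - u) * s" .
    then show ?case
      using elim(2) by (simp add: s_def[symmetric] nonzero_eq_divide_eq algebra_simps)
  qed
  ultimately show ?thesis
    unfolding has_field_derivative_iff r2_def by (rule Lim_transform_eventually)
qed

end

section \<open>Inverses of decreasing differentiable functions\<close>

context
  fixes f f' :: "real \<Rightarrow> real"
  assumes der: "\<And>x. x > 0 \<Longrightarrow> (f has_real_derivative f' x) (at x)"
    and neg: "\<And>x. x > 0 \<Longrightarrow> f' x < 0"
begin

lemma DERIV_neg_imp_strict_antimono:
  assumes "0 < a" "a < b"
  shows "f b < f a"
proof (rule DERIV_neg_imp_decreasing[OF assms(2)])
  show "\<exists>y. (f has_real_derivative y) (at x) \<and> y < 0" if "a \<le> x" for x
    using der[of x] neg[of x] assms(1) that by (intro exI[of _ "f' x"]) auto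
qed

lemma the_inv_into_decreasing:
  assumes "x > 0"
  shows "the_inv_into {0<..} f (f x) = x"
proof (rule the_inv_into_f_f)
  show "inj_on f {0<..}"
    using DERIV_neg_imp_strict_antimono by (intro linorder_inj_onI') force
qed (use assms in simp)

lemma DERIV_the_inv_into:
  assumes x: "x > 0"
  shows "(the_inv_into {0<..} f has_real_derivative inverse (f' x)) (at (f x))"
proof -
  let ?g = "the_inv_into {0<..} f"
  note dec = DERIV_neg_imp_strict_antimono and inv = the_inv_into_decreasing
  have cont: "isCont f z" if "z > 0" for z using der[OF that] by (rule DERIV_isCont)
  \<comment> \<open>A bracket around \<open>x\<close> inside the positive half-line. By the
    intermediate value theorem every value between \<open>f ?b\<close> and \<open>f ?a\<close> is
    attained on it, which makes the inverse a right inverse near \<open>f x\<close>.\<close>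
  let ?a = "x / 2" and ?b = "x + 1"
  have "(?g has_real_derivative inverse (f' x)) (at (f x))"
  proof (rule DERIV_inverse_function)
    show "(f has_real_derivative f' x) (at (?g (f x)))" using inv der x by simp
    show "f' x \<noteq> 0" using neg[OF x] by simp
    show "f ?b < f x" "f x < f ?a" using dec x by auto
    show "f (?g y) = y" if y: "f ?b < y" "y < f ?a" for y
    proof -
      obtain z where "?a \<le> z" "z \<le> ?b" "f z = y"
        using IVT2[of f ?b y ?a] y x cont by auto
      then show ?thesis using inv[of z] x by auto
    qed
    show "isCont ?g (f x)"
      by (rule isCont_inverse_function2[of ?a x ?b]) (use x inv cont in auto)
  qed
  then show ?thesis .
qed

end

section \<open>The functions R1, R2 and K on the torus\<close>

lemma torus_dissipative:
  assumes "L \<ge> 1" "t > 0"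
  shows "dissipative_matrix (L ^ d) (t \<cdot>\<^sub>m torus_laplacian L d)"
proof
  show "0 < L ^ d" using assms by simp
  show "t \<cdot>\<^sub>m torus_laplacian L d \<in> carrier_mat (L ^ d) (L ^ d)" by simp
  fix j k :: nat assume jk: "j < L ^ d" "k < L ^ d"
  show "(t \<cdot>\<^sub>m torus_laplacian L d) $$ (j, k) = (t \<cdot>\<^sub>m torus_laplacian L d) $$ (k, j)"
    using jk torus_laplacian_sym[OF jk] by (simp add: carrier_matD[OF torus_laplacian_carrier])
next
  fix x :: "nat \<Rightarrow> real"
  have "(\<Sum>j<L ^ d. \<Sum>k<L ^ d. (t \<cdot>\<^sub>m torus_laplacian L d) $$ (j, k) * x j * x k)
    = t * (\<Sum>j<L ^ d. \<Sum>k<L ^ d. torus_laplacian L d $$ (j, k) * x j * x k)"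
    unfolding sum_distrib_left
    by (intro sum.cong refl) (simp add: carrier_matD[OF torus_laplacian_carrier])
  also have "\<dots> \<le> 0"
    using torus_laplacian_form_nonpos assms(2) by (intro mult_nonneg_nonpos) auto
  finally show "(\<Sum>j<L ^ d. \<Sum>k<L ^ d. (t \<cdot>\<^sub>m torus_laplacian L d) $$ (j, k) * x j * x k) \<le> 0" .
qed

locale torus =
  fixes L d :: nat and t :: real
  assumes L_ge: "L \<ge> 1" and t_pos: "t > 0"
begin

sublocale dissipative_matrix "L ^ d" "t \<cdot>\<^sub>m torus_laplacian L d"
  by (rule torus_dissipative[OF L_ge t_pos])

abbreviation "R1 \<equiv> R_fun L d t 1"
abbreviation "R2 \<equiv> R_fun L d t 2"
abbreviation "K \<equiv> K_fun L d t"

lemma R_fun_eq: "u > 0 \<Longrightarrow> R1 u = r1 u" "u > 0 \<Longrightarrow> R2 u = r2 u"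
  using normalized_trace_G[of u] by (simp_all add: R_fun_def G_def M_def)

lemma R1_pos: "u > 0 \<Longrightarrow> R1 u > 0" and R2_pos: "u > 0 \<Longrightarrow> R2 u > 0"
  by (simp_all add: R_fun_eq r1_pos r2_pos del: One_nat_def)

lemma R1_deriv: "u > 0 \<Longrightarrow> (R1 has_real_derivative - R2 u) (at u)"
  using has_field_derivative_transform_within_open[OF r1_has_derivative[of u], of "{0<..}" R1]
  by (simp add: R_fun_eq del: One_nat_def)

lemma isCont_R1: "u > 0 \<Longrightarrow> isCont R1 u"
  using R1_deriv by (rule DERIV_isCont)

lemma isCont_R2:
  assumes "u > 0"
  shows "isCont R2 u"
proof -
  have "\<forall>\<^sub>F v in nhds u. v \<in> {0<..}"
    using assms by (intro eventually_nhds_in_open) auto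
  then have "\<forall>\<^sub>F v in nhds u. R2 v = r2 v"
    by eventually_elim (simp add: R_fun_eq)
  then show ?thesis using isCont_cong isCont_r2[OF assms] by blast
qed

lemma R2_tendsto_0: "(R2 \<longlongrightarrow> 0) at_top"
proof (rule Lim_null_comparison)
  show "\<forall>\<^sub>F u in at_top. norm (R2 u) \<le> 1 / u\<^sup>2 * (L ^ d)"
    using eventually_gt_at_top[of 0]
    by eventually_elim (use r2_le r2_pos in \<open>auto simp: R_fun_eq less_imp_le\<close>)
  show "((\<lambda>u. 1 / u\<^sup>2 * real (L ^ d)) \<longlongrightarrow> 0) at_top"
    by real_asymp
qed

lemma R1_preimage:
  assumes "\<mu> > 0" "0 < y" "y \<le> R1 \<mu>"
  obtains v where "v \<ge> \<mu>" "R1 v = y"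
proof -
  \<comment> \<open>The entry \<open>1 / y\<close> forces \<open>R1 w \<le> 1 / w \<le> y\<close>;
    the entry \<open>\<mu>\<close> makes \<open>{\<mu>..w}\<close> an interval for the intermediate
    value theorem.\<close>
  define w where "w = max \<mu> (1 / y)"
  have w: "w > 0" "w \<ge> \<mu>" "w \<ge> 1 / y" using assms by (auto simp: w_def)
  have "R1 w \<le> 1 / w" using r1_le[OF w(1)] w(1) by (simp add: R_fun_eq del: One_nat_def)
  also have "\<dots> \<le> y" using w assms(2) by (simp add: field_simps)
  finally show thesis
    using IVT2[of R1 w y \<mu>] w assms isCont_R1 that by auto
qed

lemma K_deriv:
  assumes "u > 0"
  shows "(K has_real_derivative inverse (- R2 u)) (at (R1 u))"
  unfolding K_fun_def
  by (rule DERIV_the_inv_into[where f' = "\<lambda>u. - R2 u"]) (use assms R1_deriv R2_pos in auto)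

lemma K_R1: "u > 0 \<Longrightarrow> K (R1 u) = u"
  unfolding K_fun_def
  by (rule the_inv_into_decreasing[where f' = "\<lambda>u. - R2 u"]) (use R1_deriv R2_pos in auto)

lemma deriv_K: "u > 0 \<Longrightarrow> deriv K (R1 u) = - 1 / R2 u"
  using DERIV_imp_deriv[OF K_deriv[of u]] by (simp add: inverse_eq_divide)

text \<open>\<open>K\<close> inverts \<open>R1\<close> only on the range of \<open>R1\<close>. By
  \<open>R1_preimage\<close> that range contains the given interval, so the derivative is
  \<open>- 1 / R2 (K y)\<close> there.\<close>

lemma continuous_deriv_K:
  assumes "\<mu> > 0"
  shows "continuous_on {0<..R1 \<mu>} (deriv K)"
proof -
  have pre: "K y > 0 \<and> R1 (K y) = y" if "y \<in> {0<..R1 \<mu>}" for y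
  proof -
    from that obtain v where "v \<ge> \<mu>" "R1 v = y"
      using R1_preimage[OF assms, of y] by auto
    then show ?thesis using K_R1[of v] assms by auto
  qed
  have "continuous_on {0<..R1 \<mu>} (\<lambda>y. - 1 / R2 (K y))"
  proof (intro continuous_at_imp_continuous_on ballI)
    fix y assume "y \<in> {0<..R1 \<mu>}"
    then have y: "K y > 0" "R1 (K y) = y" using pre by auto
    have "isCont K y" using DERIV_isCont[OF K_deriv[OF y(1)]] y(2) by simp
    moreover have "isCont R2 (K y)" by (rule isCont_R2[OF y(1)])
    ultimately have "isCont (\<lambda>y. R2 (K y)) y" by (rule isCont_o2)
    then show "isCont (\<lambda>y. - 1 / R2 (K y)) y"
      using R2_pos[OF y(1)] by (simp add: continuous_divide)
  qed
  moreover have "- 1 / R2 (K y) = deriv K y" if "y \<in> {0<..R1 \<mu>}" for y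
    using pre[OF that] deriv_K[of "K y"] by simp
  ultimately show ?thesis by (rule continuous_on_eq)
qed

end

subsection \<open>Derivatives of the correlation function\<close>

text \<open>The tangent inequality at both points puts the remainder between 0 and
  \<open>(p - q) * (exp p - exp q)\<close>; on the non-positive half-line \<open>exp\<close> is
  1-Lipschitz.\<close>

lemma exp_remainder_bound:
  fixes p q :: real
  assumes "p \<le> 0" "q \<le> 0"
  shows "\<bar>exp p - exp q - (p - q) * exp q\<bar> \<le> (p - q)\<^sup>2"
proof -
  have tangent: "(a - b) * exp b \<le> exp a - exp b" for a b :: real
    using mult_right_mono[OF exp_ge_add_one_self[of "a - b"], of "exp b"]
    by (simp add: exp_diff algebra_simps)
  have "(p - q) * (exp p - exp q) \<le> \<bar>p - q\<bar> * \<bar>exp p - exp q\<bar>"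
    by (simp flip: abs_mult)
  also have "\<dots> \<le> \<bar>p - q\<bar> * \<bar>p - q\<bar>"
  proof (rule mult_left_mono)
    have lip: "exp b - exp a \<le> b - a" if "a \<le> b" "b \<le> 0" for a b :: real
      using tangent[of a b] mult_left_mono[of "exp b" 1 "b - a"] that by (simp add: algebra_simps)
    show "\<bar>exp p - exp q\<bar> \<le> \<bar>p - q\<bar>"
      using lip[of p q] lip[of q p] assms by (cases "p \<le> q") auto
  qed simp
  finally show ?thesis
    using tangent[of p q] tangent[of q p] by (simp add: power2_eq_square algebra_simps)
qed

lemma power_le_fact_exp:
  fixes x :: real
  assumes "x \<ge> 0"
  shows "x ^ k \<le> fact k * exp x"
proof -
  have "x ^ k /\<^sub>R fact k = (\<Sum>n\<in>{k}. x ^ n /\<^sub>R fact n)" by simp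
  also have "\<dots> \<le> (\<Sum>n. x ^ n /\<^sub>R fact n)"
    using assms summable_exp_generic[of x] by (intro sum_le_suminf) auto
  finally show ?thesis by (simp add: exp_def field_simps)
qed

locale exp_moment_measure = finite_measure \<nu> for \<nu> :: "real measure" +
  fixes \<epsilon> :: real
  assumes sets_eq [simp, measurable_cong]: "sets \<nu> = sets borel"
    and \<epsilon>_pos: "\<epsilon> > 0"
    and nonpos_null: "emeasure \<nu> {..0} = 0"
    and pos_not_null: "emeasure \<nu> {0<..} \<noteq> 0"
    and exp_moment: "integrable \<nu> (\<lambda>l. exp (\<epsilon> * l\<^sup>2))"
begin

text \<open>For positive \<open>y\<close> this is \<open>(- 1) ^ k\<close> times the
  \<open>k\<close>-th derivative of the correlation function.\<close>

definition moment :: "nat \<Rightarrow> real \<Rightarrow> real" where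
  "moment k y = (LINT l|\<nu>. (l\<^sup>2) ^ k * exp (- (l\<^sup>2 * y)))"

lemma AE_pos: "AE l in \<nu>. l > 0"
  using nonpos_null by (intro AE_I[of _ _ "{..0}"]) auto

lemma space_not_null: "emeasure \<nu> (space \<nu>) \<noteq> 0"
  using pos_not_null emeasure_space[of \<nu> "{0<..}"] by auto

text \<open>One term of the exponential series bounds each power by a multiple of the integrable
  exponential.\<close>

lemma integrable_power: "integrable \<nu> (\<lambda>l. (l\<^sup>2) ^ k)"
proof (rule Bochner_Integration.integrable_bound)
  show "integrable \<nu> (\<lambda>l. fact k / \<epsilon> ^ k * exp (\<epsilon> * l\<^sup>2))"
    using exp_moment by simp
  have "(l\<^sup>2) ^ k \<le> fact k / \<epsilon> ^ k * exp (\<epsilon> * l\<^sup>2)" for l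
    using power_le_fact_exp[of "\<epsilon> * l\<^sup>2" k] \<epsilon>_pos by (simp add: power_mult_distrib field_simps)
  then show "AE l in \<nu>. norm ((l\<^sup>2) ^ k) \<le> norm (fact k / \<epsilon> ^ k * exp (\<epsilon> * l\<^sup>2))"
    by (intro AE_I2) (metis abs_ge_self order_trans real_norm_def zero_le_power zero_le_power2 abs_of_nonneg)
qed simp

lemma integrable_moment:
  assumes "y \<ge> 0"
  shows "integrable \<nu> (\<lambda>l. (l\<^sup>2) ^ k * exp (- (l\<^sup>2 * y)))"
proof (rule Bochner_Integration.integrable_bound[OF integrable_power[of k]])
  show "AE l in \<nu>. norm ((l\<^sup>2) ^ k * exp (- (l\<^sup>2 * y))) \<le> norm ((l\<^sup>2) ^ k)"
    using assms by (intro AE_I2) (simp add: abs_mult mult_left_le)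
qed simp

lemma moment_le: "y \<ge> 0 \<Longrightarrow> moment k y \<le> moment k 0"
  unfolding moment_def using integrable_moment[of y k] integrable_moment[of 0 k]
  by (intro integral_mono) (auto simp: mult_left_le)

lemma moment_pos:
  assumes "y \<ge> 0"
  shows "moment k y > 0"
proof -
  have "AE l in \<nu>. 0 < (l\<^sup>2) ^ k * exp (- (l\<^sup>2 * y))"
    using AE_pos by eventually_elim simp
  then have "(LINT l|\<nu>. 0) < (LINT l|\<nu>. (l\<^sup>2) ^ k * exp (- (l\<^sup>2 * y)))"
    using integrable_moment[OF assms] space_not_null by (intro integral_less_AE_space) auto
  then show ?thesis by (simp add: moment_def)
qed

lemma moment_strict_antimono:
  assumes "0 \<le> x" "x < y"
  shows "moment k y < moment k x"
  unfolding moment_def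
proof (rule integral_less_AE_space)
  show "AE l in \<nu>. (l\<^sup>2) ^ k * exp (- (l\<^sup>2 * y)) < (l\<^sup>2) ^ k * exp (- (l\<^sup>2 * x))"
    using AE_pos by eventually_elim (use assms in simp)
qed (use assms integrable_moment space_not_null in auto)

text \<open>Differentiation under the integral: \<open>exp_remainder_bound\<close> controls the
  integrand to second order, and integration leaves an error of at most
  \<open>(z - y)\<^sup>2 * C\<close>, with \<open>C\<close> finite by
  \<open>integrable_power\<close>.\<close>

lemma moment_has_derivative:
  assumes "y > 0"
  shows "(moment k has_real_derivative - moment (Suc k) y) (at y)"
proof -
  define C where "C = (LINT l|\<nu>. (l\<^sup>2) ^ (k + 2))"
  have bound: "\<bar>moment k z - moment k y + (z - y) * moment (Suc k) y\<bar> \<le> (z - y)\<^sup>2 * C"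
    if "z > 0" for z
  proof -
    let ?h = "\<lambda>l. (l\<^sup>2) ^ k * exp (- (l\<^sup>2 * z)) - (l\<^sup>2) ^ k * exp (- (l\<^sup>2 * y))
      + (z - y) * ((l\<^sup>2) ^ Suc k * exp (- (l\<^sup>2 * y)))"
    have int: "integrable \<nu> ?h"
      by (intro Bochner_Integration.integrable_add Bochner_Integration.integrable_diff integrable_mult_right
          integrable_moment) (use that assms in auto)
    have eq: "moment k z - moment k y + (z - y) * moment (Suc k) y = (LINT l|\<nu>. ?h l)"
      unfolding moment_def using that assms
      by (simp add: Bochner_Integration.integral_add Bochner_Integration.integral_diff
          integrable_moment del: power_Suc)
    have "\<bar>?h l\<bar> \<le> (z - y)\<^sup>2 * (l\<^sup>2) ^ (k + 2)" for l
    proof -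
      let ?a = "l\<^sup>2"
      have "?h l = ?a ^ k * (exp (- (?a * z)) - exp (- (?a * y)) - (- (?a * z) - - (?a * y)) * exp (- (?a * y)))"
        by (simp add: algebra_simps)
      also have "\<bar>\<dots>\<bar> \<le> ?a ^ k * (- (?a * z) - - (?a * y))\<^sup>2"
        unfolding abs_mult using exp_remainder_bound[of "- (?a * z)" "- (?a * y)"] that assms
        by (intro mult_mono) auto
      also have "\<dots> = (z - y)\<^sup>2 * ?a ^ (k + 2)"
        by (simp add: power_add power2_eq_square algebra_simps)
      finally show ?thesis .
    qed
    then have "\<bar>LINT l|\<nu>. ?h l\<bar> \<le> (LINT l|\<nu>. (z - y)\<^sup>2 * (l\<^sup>2) ^ (k + 2))"
      using int integrable_power[of "k + 2"]
      by (intro order_trans[OF integral_abs_bound integral_mono]) auto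
    then show ?thesis unfolding eq C_def by simp
  qed
  have "\<forall>\<^sub>F z in at y. 0 < z"
    using assms by (intro order_tendstoD(1)[of "\<lambda>x. x" y]) auto
  then have "\<forall>\<^sub>F z in at y. norm ((moment k z - moment k y) / (z - y) - (- moment (Suc k) y)) \<le> \<bar>z - y\<bar> * C"
    using eventually_neq_at_within[of y y UNIV]
  proof eventually_elim
    case (elim z)
    have "norm ((moment k z - moment k y) / (z - y) - (- moment (Suc k) y))
      = \<bar>moment k z - moment k y + (z - y) * moment (Suc k) y\<bar> / \<bar>z - y\<bar>"
      using elim(2) by (simp add: field_simps flip: abs_divide)
    also have "\<dots> \<le> (z - y)\<^sup>2 * C / \<bar>z - y\<bar>"
      using bound[OF elim(1)] by (simp add: divide_right_mono)
    also have "\<dots> = \<bar>z - y\<bar> * C"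
      using elim(2) by (simp add: field_simps power2_eq_square flip: abs_mult)
    finally show ?case .
  qed
  moreover have "((\<lambda>z. \<bar>z - y\<bar> * C) \<longlongrightarrow> 0) (at y)"
    by (intro tendsto_mult_left_zero tendsto_rabs_zero) (auto intro!: tendsto_eq_intros)
  ultimately have "((\<lambda>z. (moment k z - moment k y) / (z - y) - (- moment (Suc k) y)) \<longlongrightarrow> 0) (at y)"
    by (rule Lim_null_comparison)
  then show ?thesis unfolding has_field_derivative_iff by (rule LIM_zero_cancel)
qed

end

lemma correlator_deriv_props:
  assumes "correlator B"
  obtains C where
    "\<And>y. y > 0 \<Longrightarrow> (deriv B has_real_derivative deriv (deriv B) y) (at y)"
    "\<And>y. y > 0 \<Longrightarrow> deriv B y < 0"
    "\<And>y. y > 0 \<Longrightarrow> isCont (deriv (deriv B)) y"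
    "\<And>y. y > 0 \<Longrightarrow> 0 < deriv (deriv B) y \<and> deriv (deriv B) y \<le> C"
    "\<And>x y. 0 < x \<Longrightarrow> x < y \<Longrightarrow> deriv (deriv B) y < deriv (deriv B) x"
proof -
  from assms obtain \<nu> \<epsilon> where nu: "exp_moment_measure \<nu> \<epsilon>"
    and B: "\<And>x. x > - \<epsilon> \<Longrightarrow> B x = (LINT l|\<nu>. exp (- (l\<^sup>2 * x)))"
    unfolding correlator_def exp_moment_measure_def exp_moment_measure_axioms_def by blast
  interpret exp_moment_measure \<nu> \<epsilon> by fact
  have "moment 0 y = B y" if "y \<in> {0<..}" for y
    using B[of y] that \<epsilon>_pos by (simp add: moment_def)
  then have d1: "(B has_real_derivative - moment 1 y) (at y)" if "y > 0" for y
    using has_field_derivative_transform_within_open[OF moment_has_derivative[OF that, of 0], of "{0<..}" B] that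
    by auto
  then have B1: "deriv B y = - moment 1 y" if "y \<in> {0<..}" for y
    using that by (auto intro: DERIV_imp_deriv)
  have d2: "(deriv B has_real_derivative moment 2 y) (at y)" if "y > 0" for y
    using has_field_derivative_transform_within_open[OF DERIV_minus[OF moment_has_derivative[OF that, of 1]], of "{0<..}" "deriv B"]
      B1 that by (simp add: numeral_2_eq_2)
  then have B2: "deriv (deriv B) y = moment 2 y" if "y \<in> {0<..}" for y
    using that by (auto intro: DERIV_imp_deriv)
  have d3: "isCont (deriv (deriv B)) y" if "y > 0" for y
    using has_field_derivative_transform_within_open[OF moment_has_derivative[OF that, of 2], of "{0<..}" "deriv (deriv B)"]
      B2 that by (auto intro: DERIV_isCont)
  \<comment> \<open>The upper bound for the second derivative is the second moment at 0.\<close>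
  show thesis
    by (rule that[of "moment 2 0"])
       (use d2 d3 B1 B2 moment_pos moment_le moment_strict_antimono in auto)
qed

subsection \<open>The Parisi pair in the stable regime\<close>

text \<open>The integrand may be unbounded at \<open>b\<close>, as the derivative of
  \<open>K\<close> is when its argument tends to 0. Each point is therefore treated on some
  \<open>{a..c}\<close> with \<open>c < b\<close>.\<close>

lemma integral_half_open:
  fixes h :: "real \<Rightarrow> real"
  assumes "continuous_on {a..<b} h"
  shows continuous_on_integral_half_open: "continuous_on {a..<b} (\<lambda>s. integral {a..s} h)"
    and DERIV_integral_half_open:
      "\<And>s. a < s \<Longrightarrow> s < b \<Longrightarrow> ((\<lambda>s. integral {a..s} h) has_real_derivative h s) (at s)"
proof -
  have der: "((\<lambda>s. integral {a..s} h) has_real_derivative h s) (at s within {a..<b})"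
    if "s \<in> {a..<b}" for s
  proof -
    define c where "c = (s + b) / 2"
    have c: "s < c" "c < b" using that by (auto simp: c_def)
    have "continuous_on {a..c} h" using assms c by (rule_tac continuous_on_subset) auto
    then have "((\<lambda>s. integral {a..s} h) has_real_derivative h s) (at s within {a..c})"
      using that c by (intro integral_has_real_derivative) auto
    also have "at s within {a..c} = at s within {a..<b}"
      using c by (intro at_within_nhd[of _ "{..<c}"]) auto
    finally show ?thesis .
  qed
  show "continuous_on {a..<b} (\<lambda>s. integral {a..s} h)"
    unfolding continuous_on_eq_continuous_within using der DERIV_continuous by blast
  show "((\<lambda>s. integral {a..s} h) has_real_derivative h s) (at s)" if "a < s" "s < b" for s
  proof -
    have "at s within {a..<b} = at s" using that by (intro at_within_interior) auto
    then show ?thesis using der[of s] that by simp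
  qed
qed

lemma eq_return_borel:
  fixes M :: "real measure"
  assumes "prob_space M" and sets: "sets M = sets borel" and AE: "AE z in M. z = a"
  shows "M = return borel a"
proof (rule measure_eqI)
  interpret prob_space M by fact
  fix A assume A: "A \<in> sets M"
  show "emeasure M A = emeasure (return borel a) A"
  proof (cases "a \<in> A")
    case True
    then have "AE z in M. z \<in> A" using AE by auto
    then show ?thesis using A True sets by (simp add: emeasure_eq_1_AE)
  next
    case False
    then have "AE z in M. z \<notin> A" using AE by auto
    then show ?thesis using A False sets AE_iff_null_sets[of A M] by (auto simp: null_sets_def)
  qed
qed (simp add: sets)

lemma delta_return:
  assumes "0 \<le> s" "s \<le> a" "a \<le> q"
  shows "delta q (return borel a) s = q - a"
proof -
  have "delta q (return borel a) s = integral {s..q} (\<lambda>u. if u \<in> {a..q} then 1 else 0)"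
    unfolding delta_def using assms
    by (intro integral_cong) (auto simp: measure_return indicator_def)
  also have "\<dots> = integral ({a..q} \<inter> {s..q}) (\<lambda>u. 1)"
    by (rule Henstock_Kurzweil_Integration.integral_restrict_Int)
  also have "{a..q} \<inter> {s..q} = {a..q}" using assms by auto
  finally show ?thesis using assms by simp
qed

text \<open>The analytic input to the Parisi problem, detached from matrices and moments. With
  \<open>y = R1 v\<close> and \<open>v \<ge> \<mu>\<close>, \<open>stable\<close> says that the
  left-hand side of the Larkin equation at \<open>v\<close> is at most 1.\<close>

locale stable_model =
  fixes L d :: nat and B :: "real \<Rightarrow> real" and t \<beta> \<mu> :: real
  assumes \<beta>_pos: "\<beta> > 0"
    and R_pos: "R_fun L d t 1 \<mu> > 0"
    and deriv_B: "\<And>y. y > 0 \<Longrightarrow> (deriv B has_real_derivative deriv (deriv B) y) (at y)"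
    and deriv_B_neg: "\<And>y. y > 0 \<Longrightarrow> deriv B y < 0"
    and deriv2_B_decreasing: "\<And>x y. 0 < x \<Longrightarrow> x < y \<Longrightarrow> deriv (deriv B) y < deriv (deriv B) x"
    and deriv_K_cont: "continuous_on {0<..R_fun L d t 1 \<mu>} (deriv (K_fun L d t))"
    and deriv_K_neg: "deriv (K_fun L d t) (R_fun L d t 1 \<mu>) < 0"
    and stable: "\<And>y. 0 < y \<Longrightarrow> y \<le> R_fun L d t 1 \<mu> \<Longrightarrow>
      4 * deriv (deriv B) (2 * y / \<beta>) + deriv (K_fun L d t) y \<le> 0"

abbreviation (in stable_model) "\<rho> \<equiv> R_fun L d t 1 \<mu>"

text \<open>All conditions on a Parisi pair except the maximization, so that the same analysis
  serves a given pair and the constructed candidate.\<close>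

locale order_parameter = stable_model +
  fixes q :: real and \<zeta> :: "real measure"
  assumes q_pos: "q > 0" and zeta: "\<zeta> \<in> Y_set q"
    and constraint: "\<beta> * integral {0..q} (\<lambda>u. measure \<zeta> {0..u}) = \<rho>"
begin

sublocale prob_space \<zeta>
  using zeta by (simp add: Y_set_def)

lemma sets_zeta [simp, measurable_cong]: "sets \<zeta> = sets borel"
  and prob_interval: "prob {0..q} = 1"
  using zeta by (auto simp: Y_set_def)

abbreviation "x u \<equiv> measure \<zeta> {0..u}"
abbreviation "\<delta> \<equiv> delta q \<zeta>"
abbreviation "F \<equiv> F_fun L d B t \<beta> q \<zeta>"
abbreviation "f \<equiv> f_fun L d B t \<beta> q \<zeta>"
abbreviation "\<phi> s \<equiv> integral {0..s} F"

lemma x_mono: "u \<le> v \<Longrightarrow> x u \<le> x v"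
  by (intro finite_measure_mono) auto

lemma x_integrable: "x integrable_on {a..b}"
  by (intro integrable_on_mono_on mono_onI x_mono)

text \<open>A null neighbourhood of \<open>q\<close> exists because \<open>q\<close> is outside the
  support; all mass lies to its left.\<close>

lemma x_eq_1_near_q: "\<exists>c<q. \<forall>u. c < u \<and> u \<le> q \<longrightarrow> x u = 1"
proof -
  from zeta obtain U where U: "open U" "q \<in> U" "emeasure \<zeta> U = 0"
    by (auto simp: Y_set_def measure_support_def)
  then obtain e where e: "e > 0" "ball q e \<subseteq> U" by (meson openE)
  have "x u = 1" if "q - e < u" "u \<le> q" for u
  proof -
    have "{u<..q} \<subseteq> U" using e that by (auto simp: dist_real_def subset_iff)
    then have "AE z in \<zeta>. z \<notin> {u<..q}"
      using U emeasure_eq_0[of U \<zeta> "{u<..q}"] by (intro AE_not_in) (auto simp: null_sets_def)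
    moreover have "AE z in \<zeta>. z \<in> {0..q}"
      using prob_interval by (subst prob_eq_1[symmetric]) auto
    ultimately have "AE z in \<zeta>. z \<in> {0..u}" by eventually_elim auto
    then show ?thesis by (subst prob_eq_1) auto
  qed
  with e(1) show ?thesis by (intro exI[of _ "q - e"]) auto
qed

lemma \<delta>_split: "s \<le> u \<Longrightarrow> u \<le> q \<Longrightarrow> \<delta> s = integral {s..u} x + \<delta> u"
  unfolding delta_def by (intro Henstock_Kurzweil_Integration.integral_combine[symmetric] x_integrable) auto

lemma integral_x_le: "s \<le> u \<Longrightarrow> integral {s..u} x \<le> (u - s) * x u"
  using integral_le[OF x_integrable integrable_const_ivl, of s u "x u"] x_mono by simp

lemma \<delta>_le: "s \<le> q \<Longrightarrow> \<delta> s \<le> q - s"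
  using integral_x_le[of s q] prob_interval by (simp add: delta_def)

text \<open>Mass missing from \<open>{0..u}\<close> keeps the distribution function below 1 on all
  of \<open>{s..u}\<close>, so \<open>\<delta> s\<close> falls short of the interval length.\<close>

lemma \<delta>_less:
  assumes "s < u" "u \<le> q" "x u \<noteq> 1"
  shows "\<delta> s < q - s"
proof -
  have "x u < 1" using assms(3) prob_le_1[of "{0..u}"] by linarith
  then have "(u - s) * x u < u - s" using assms(1) by simp
  then show ?thesis
    using \<delta>_split[of s u] integral_x_le[of s u] \<delta>_le[of u] assms by linarith
qed

lemma \<delta>_antimono: "s \<le> u \<Longrightarrow> u \<le> q \<Longrightarrow> \<delta> u \<le> \<delta> s"
  using \<delta>_split[of s u] integral_nonneg[OF x_integrable, of s u] by simp

text \<open>Keeps the argument of the derivative of \<open>K\<close> positive for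
  \<open>s < q\<close>: near \<open>q\<close> the distribution function equals 1.\<close>

lemma \<delta>_pos:
  assumes "s < q"
  shows "\<delta> s > 0"
proof -
  from x_eq_1_near_q obtain c where c: "c < q" "\<And>u. c < u \<Longrightarrow> u \<le> q \<Longrightarrow> x u = 1" by blast
  define r where "r = (max c s + q) / 2"
  have r: "c < r" "s < r" "r < q" using c(1) assms by (auto simp: r_def)
  have "\<delta> r = integral {r..q} (\<lambda>u. 1)"
    unfolding delta_def using c(2) r by (intro integral_cong) auto
  then have "\<delta> r > 0" using r by simp
  then show ?thesis using \<delta>_antimono[of s r] r by simp
qed

lemma \<delta>_0: "\<beta> * \<delta> 0 = \<rho>"
  using constraint by (simp add: delta_def)

lemma \<delta>_range:
  assumes "0 \<le> s" "s < q"
  shows "\<beta> * \<delta> s \<in> {0<..\<rho>}"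
  using \<delta>_pos[of s] mult_left_mono[OF \<delta>_antimono[of 0 s], of \<beta>] assms \<beta>_pos \<delta>_0 by simp

lemma \<delta>_cont: "continuous_on {0..<q} \<delta>"
  unfolding delta_def
  by (rule continuous_on_subset[OF indefinite_integral_continuous_1'[OF x_integrable]]) auto

lemma K_\<delta>_cont: "continuous_on {0..<q} (\<lambda>s. deriv (K_fun L d t) (\<beta> * \<delta> s))"
  by (rule continuous_on_compose2[OF deriv_K_cont]) (use \<delta>_range in \<open>auto intro!: continuous_intros \<delta>_cont\<close>)

lemma F_cont: "continuous_on {0..<q} F"
proof -
  have "continuous_on {0..<q} (\<lambda>s. deriv B (2 * (q - s)))"
  proof (rule continuous_on_compose2[of "{0<..}" "deriv B"])
    show "continuous_on {0<..} (deriv B)"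
      by (intro continuous_at_imp_continuous_on ballI DERIV_isCont[OF deriv_B]) auto
  qed (auto intro!: continuous_intros)
  then show ?thesis
    unfolding F_fun_def by (intro continuous_intros continuous_on_integral_half_open K_\<delta>_cont)
qed

lemma F_deriv:
  assumes "0 < s" "s < q"
  shows "(F has_real_derivative
    4 * deriv (deriv B) (2 * (q - s)) + deriv (K_fun L d t) (\<beta> * \<delta> s)) (at s)"
proof -
  have "((\<lambda>s. 2 * (q - s)) has_real_derivative -2) (at s)"
    by (auto intro!: derivative_eq_intros)
  then have "((\<lambda>s. deriv B (2 * (q - s))) has_real_derivative deriv (deriv B) (2 * (q - s)) * -2) (at s)"
    using assms by (intro DERIV_chain2[OF deriv_B]) auto
  then show ?thesis
    unfolding F_fun_def using assms
    by (auto intro!: derivative_eq_intros DERIV_integral_half_open[OF K_\<delta>_cont])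
qed

lemma F_slope_nonpos:
  assumes "0 \<le> s" "s < q"
  shows "4 * deriv (deriv B) (2 * (q - s)) + deriv (K_fun L d t) (\<beta> * \<delta> s) \<le> 0"
    and "\<delta> s < q - s \<Longrightarrow> 4 * deriv (deriv B) (2 * (q - s)) + deriv (K_fun L d t) (\<beta> * \<delta> s) < 0"
proof -
  \<comment> \<open>Stability at \<open>y = \<beta> * \<delta> s\<close>, where the factor
    \<open>\<beta>\<close> cancels in the argument of the second derivative of
    \<open>B\<close>.\<close>
  have st: "4 * deriv (deriv B) (2 * \<delta> s) + deriv (K_fun L d t) (\<beta> * \<delta> s) \<le> 0"
    using stable[of "\<beta> * \<delta> s"] \<delta>_range[OF assms] \<beta>_pos by simp
  show less: "4 * deriv (deriv B) (2 * (q - s)) + deriv (K_fun L d t) (\<beta> * \<delta> s) < 0"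
    if "\<delta> s < q - s"
    using st deriv2_B_decreasing[of "2 * \<delta> s" "2 * (q - s)"] \<delta>_pos[of s] assms that by simp
  show "4 * deriv (deriv B) (2 * (q - s)) + deriv (K_fun L d t) (\<beta> * \<delta> s) \<le> 0"
    using st less \<delta>_le[of s] assms by (cases "\<delta> s = q - s") auto
qed

lemma F_antimono:
  assumes "0 \<le> a" "a \<le> b" "b < q"
  shows "F b \<le> F a"
proof (rule DERIV_nonpos_imp_decreasing_open[OF assms(2)])
  show "\<exists>y. (F has_real_derivative y) (at s) \<and> y \<le> 0" if "a < s" "s < b" for s
    using F_deriv[of s] F_slope_nonpos(1)[of s] that assms by (meson less_imp_le less_trans order_le_less_trans)
  show "continuous_on {a..b} F" using assms by (intro continuous_on_subset[OF F_cont]) auto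
qed

lemma F_0: "F 0 > 0"
  using deriv_B_neg[of "2 * q"] q_pos by (simp add: F_fun_def)

lemmas \<phi>_cont = continuous_on_integral_half_open[OF F_cont]
  and \<phi>_deriv = DERIV_integral_half_open[OF F_cont]

lemma f_eq: "s < q \<Longrightarrow> f s = ereal (\<phi> s)"
  by (simp add: f_fun_def)

text \<open>At \<open>q\<close> the value is minus infinity, below the finite value at
  \<open>q / 2\<close>; at 0 the function starts to increase because \<open>F 0 > 0\<close>. An
  interior maximizer is a critical point.\<close>

lemma maximizerD:
  assumes "s \<in> {0..q}" "f s = (SUP s'\<in>{0<..<q}. f s')"
  shows "0 < s" "s < q" "F s = 0"
proof -
  have max: "f s' \<le> f s" if "s' \<in> {0<..<q}" for s'
    unfolding assms(2) using that by (rule SUP_upper)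
  show "s < q"
    using max[of "q / 2"] assms(1) q_pos by (cases "s = q") (auto simp: f_fun_def)
  then have max': "\<phi> s' \<le> \<phi> s" if "s' \<in> {0<..<q}" for s'
    using max[OF that] that by (simp add: f_eq)
  show "0 < s"
  proof (rule ccontr)
    assume "\<not> 0 < s"
    then have s: "s = 0" using assms(1) by auto
    have "continuous (at 0 within {0..<q}) F"
      using F_cont q_pos by (auto simp: continuous_on_eq_continuous_within)
    then obtain e where e: "e > 0" "\<And>s'. s' \<in> {0..<q} \<Longrightarrow> dist s' 0 < e \<Longrightarrow> dist (F s') (F 0) < F 0"
      using F_0 unfolding continuous_within_eps_delta by blast
    define r where "r = min e q / 2"
    have r: "0 < r" "r < e" "r < q" using e(1) q_pos by (auto simp: r_def min_def)
    have "\<phi> 0 < \<phi> r"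
    proof (rule DERIV_pos_imp_increasing_open[OF r(1)])
      show "\<exists>y. (\<phi> has_real_derivative y) (at s') \<and> y > 0" if "0 < s'" "s' < r" for s'
        using \<phi>_deriv[of s'] e(2)[of s'] that r by (intro exI[of _ "F s'"]) (auto simp: dist_real_def)
      show "continuous_on {0..r} \<phi>" using r by (intro continuous_on_subset[OF \<phi>_cont]) auto
    qed
    then show False using max'[of r] r s by auto
  qed
  show "F s = 0"
  proof (rule DERIV_local_max[OF \<phi>_deriv])
    show "0 < min s (q - s)" using \<open>0 < s\<close> \<open>s < q\<close> by simp
    show "\<forall>y. \<bar>s - y\<bar> < min s (q - s) \<longrightarrow> \<phi> y \<le> \<phi> s"
      using max' by (auto simp: abs_less_iff)
  qed fact+
qed

text \<open>Two maximizers force \<open>F\<close> to vanish between them; as \<open>F\<close> has negative slope wherever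
  \<open>\<delta> s < q - s\<close>, no mass lies above the smaller one.\<close>

lemma two_maximizers:
  assumes a: "a \<in> {0..q}" "f a = (SUP s'\<in>{0<..<q}. f s')"
    and b: "b \<in> {0..q}" "f b = (SUP s'\<in>{0<..<q}. f s')"
    and ab: "a < b" and u: "a < u" "u \<le> q"
  shows "x u = 1"
proof (rule ccontr)
  assume ne: "x u \<noteq> 1"
  note a' = maximizerD[OF a] and b' = maximizerD[OF b]
  \<comment> \<open>A point strictly between the maximizers, where \<open>F\<close> is locally
    constant, and strictly below \<open>u\<close>, so that missing mass would make the slope
    negative.\<close>
  define s where "s = (a + min u b) / 2"
  have s: "a < s" "s < u" "s < b" using ab u by (auto simp: s_def min_def)
  have zero: "F z = 0" if "a \<le> z" "z \<le> b" for z
    using F_antimono[of a z] F_antimono[of z b] that a' b' by auto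
  have "4 * deriv (deriv B) (2 * (q - s)) + deriv (K_fun L d t) (\<beta> * \<delta> s) = 0"
  proof (rule DERIV_local_const[OF F_deriv])
    show "0 < min (s - a) (b - s)" using s by simp
    show "\<forall>y. \<bar>s - y\<bar> < min (s - a) (b - s) \<longrightarrow> F s = F y" using zero s by auto
  qed (use s a' b' in auto)
  moreover have "\<delta> s < q - s" using \<delta>_less[OF s(2) u(2) ne] .
  ultimately show False using F_slope_nonpos(2)[of s] s a' b' by auto
qed

text \<open>A single maximizer carries all mass. If there are several, \<open>two_maximizers\<close>
  leaves no mass above their infimum, and the maximizers themselves lie at or above it.\<close>

lemma maximizing_is_return:
  assumes "prob {s \<in> {0..q}. f s = (SUP s'\<in>{0<..<q}. f s')} = 1" (is "prob ?S = 1")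
  obtains a where "\<zeta> = return borel a" "a \<in> {0..q}" "f a = (SUP s'\<in>{0<..<q}. f s')"
proof -
  \<comment> \<open>\<open>measure\<close> is 0 by default on non-measurable sets, so the value 1
    already yields measurability.\<close>
  have "?S \<in> events" using assms measure_notin_sets[of ?S \<zeta>] by force
  then have AE_S: "AE z in \<zeta>. z \<in> ?S" using assms prob_eq_1 by blast
  have "?S \<noteq> {}" using assms by (metis measure_empty zero_neq_one)
  have "\<exists>a. AE z in \<zeta>. z = a"
  proof (cases "\<exists>c. ?S \<subseteq> {c}")
    case True
    then obtain c where c: "?S \<subseteq> {c}" ..
    have "AE z in \<zeta>. z = c" using AE_S by eventually_elim (use c in blast)
    then show ?thesis ..
  next
    case False
    from \<open>?S \<noteq> {}\<close> obtain c where "c \<in> ?S" by blast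
    moreover from False obtain c' where "c' \<in> ?S" "c' \<noteq> c" by blast
    ultimately obtain c\<^sub>1 c\<^sub>2 where c: "c\<^sub>1 \<in> ?S" "c\<^sub>2 \<in> ?S" "c\<^sub>1 < c\<^sub>2"
      using that by (cases c c' rule: linorder_cases) blast+
    \<comment> \<open>The infimum is not yet known to be a maximizer, hence the approach by
      \<open>s\<close> in \<open>?S\<close> with \<open>s < u\<close>.\<close>
    define a where "a = Inf ?S"
    have bdd: "bdd_below ?S" by (rule bdd_belowI[of _ 0]) auto
    have "a \<le> c\<^sub>1" unfolding a_def using c(1) bdd by (rule cInf_lower)
    then have "a < q" using maximizerD(2)[of c\<^sub>1] c(1) by simp
    have x1: "x u = 1" if u: "a < u" "u \<le> q" for u
    proof -
      have two: "x u = 1" if "s \<in> ?S" "r \<in> ?S" "s < r" "s < u" for s r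
        using two_maximizers[of s r u] that u(2) by simp
      obtain s where s: "s \<in> ?S" "s < u"
        using cInf_lessD[OF \<open>?S \<noteq> {}\<close> u(1)[unfolded a_def]] by blast
      \<comment> \<open>\<open>s\<close> needs a partner above it: \<open>c\<^sub>2\<close> if
        \<open>s < c\<^sub>2\<close>; otherwise the pair \<open>c\<^sub>1\<close>,
        \<open>c\<^sub>2\<close> itself lies below \<open>u\<close>.\<close>
      show ?thesis
      proof (cases "s < c\<^sub>2")
        case True
        then show ?thesis using two[OF s(1) c(2)] s(2) by simp
      next
        case False
        then show ?thesis using two[OF c] c(3) s(2) by simp
      qed
    qed
    \<comment> \<open>A sequence of right endpoints decreasing to \<open>a\<close> lets countably
      many null sets be merged into one.\<close>
    have "AE z in \<zeta>. z \<in> {0..a + (q - a) / real (Suc n)}" for n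
    proof -
      have "(q - a) / real (Suc n) \<le> (q - a) / 1" "0 < (q - a) / real (Suc n)"
        using \<open>a < q\<close> mult_left_mono[of "1 / real (Suc n)" 1 "q - a"] by simp_all
      then have "x (a + (q - a) / real (Suc n)) = 1" by (intro x1) auto
      then show ?thesis by (subst (asm) prob_eq_1) auto
    qed
    then have "AE z in \<zeta>. \<forall>n. z \<in> {0..a + (q - a) / real (Suc n)}"
      by (simp add: AE_all_countable)
    then have "AE z in \<zeta>. z = a" using AE_S
    proof eventually_elim
      case (elim z)
      have "(\<lambda>n. a + (q - a) * (1 / real (Suc n))) \<longlonglongrightarrow> a + (q - a) * 0"
        by (intro tendsto_intros LIMSEQ_Suc[OF lim_1_over_n])
      then have "z \<le> a"
        using elim(1) by (intro LIMSEQ_le_const[where X = "\<lambda>n. a + (q - a) * (1 / real (Suc n))"]) auto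
      moreover have "a \<le> z" unfolding a_def using elim(2) bdd by (rule cInf_lower)
      ultimately show ?case by simp
    qed
    then show ?thesis ..
  qed
  then obtain a where a: "AE z in \<zeta>. z = a" ..
  from a AE_S have "AE z in \<zeta>. a \<in> ?S" by eventually_elim simp
  \<comment> \<open>A statement free of \<open>z\<close> that holds almost everywhere is true, as
    the measure is a probability.\<close>
  then have "a \<in> ?S" by (simp only: AE_const)
  then show thesis using that eq_return_borel[OF prob_space_axioms sets_zeta a] by blast
qed

end

section \<open>The explicit replica symmetric pair\<close>

context stable_model
begin

text \<open>The root in \<open>a\<close> of the affine expression in
  \<open>F_return\<close>.\<close>

definition rs_site :: real where
  "rs_site = 2 * deriv B (2 * \<rho> / \<beta>) / deriv (K_fun L d t) \<rho>"

text \<open>The endpoint forced by the constraint, which for a Dirac mass at \<open>a\<close> reads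
  \<open>\<beta> * (q - a) = \<rho>\<close>.\<close>

definition rs_end :: real where "rs_end = rs_site + \<rho> / \<beta>"

lemma rs_site_pos: "rs_site > 0"
  using deriv_B_neg[of "2 * \<rho> / \<beta>"] deriv_K_neg R_pos \<beta>_pos
  by (auto simp: rs_site_def intro!: divide_neg_neg)

lemma rs_site_less_end: "rs_site < rs_end"
  using R_pos \<beta>_pos by (simp add: rs_end_def)

text \<open>For a Dirac mass at \<open>a\<close>, \<open>delta\<close> is constant on
  \<open>{0..a}\<close>, so the integral in \<open>F_fun\<close> is linear in
  \<open>a\<close>.\<close>

lemma F_return:
  assumes "0 \<le> a" "a < q" "\<beta> * (q - a) = \<rho>"
  shows "F_fun L d B t \<beta> q (return borel a) a =
    -2 * deriv B (2 * \<rho> / \<beta>) + a * deriv (K_fun L d t) \<rho>"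
proof -
  have "integral {0..a} (\<lambda>u. deriv (K_fun L d t) (\<beta> * delta q (return borel a) u))
      = integral {0..a} (\<lambda>u. deriv (K_fun L d t) \<rho>)"
    using assms by (intro integral_cong) (simp add: delta_return)
  moreover have "q - a = \<rho> / \<beta>" using assms \<beta>_pos by (simp add: field_simps)
  ultimately show ?thesis using assms(1) by (simp add: F_fun_def)
qed

lemma parisi_pair_unique:
  assumes "parisi_pair L d B t \<beta> \<mu> (q, \<zeta>)"
  shows "q = rs_end" "\<zeta> = return borel rs_site"
proof -
  interpret order_parameter L d B t \<beta> \<mu> q \<zeta>
    using assms by unfold_locales (auto simp: parisi_pair_def)
  have "prob {s \<in> {0..q}. f s = (SUP s'\<in>{0<..<q}. f s')} = 1"
    using assms by (simp add: parisi_pair_def)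
  then obtain a where a: "\<zeta> = return borel a" "a \<in> {0..q}" "f a = (SUP s'\<in>{0<..<q}. f s')"
    by (rule maximizing_is_return)
  note a' = maximizerD[OF a(2,3)]
  have r: "\<beta> * (q - a) = \<rho>" using \<delta>_0 a' unfolding a(1) by (simp add: delta_return)
  have "-2 * deriv B (2 * \<rho> / \<beta>) + a * deriv (K_fun L d t) \<rho> = 0"
    using F_return[OF _ a'(2) r] a' unfolding a(1) by simp
  then have "a = rs_site" using deriv_K_neg by (simp add: rs_site_def field_simps)
  moreover have "q = a + \<rho> / \<beta>" using r \<beta>_pos by (simp add: field_simps)
  ultimately show "q = rs_end" "\<zeta> = return borel rs_site" using a(1) by (simp_all add: rs_end_def)
qed

lemma parisi_pair_rs: "parisi_pair L d B t \<beta> \<mu> (rs_end, return borel rs_site)"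
proof -
  let ?a = rs_site and ?q = rs_end and ?Z = "return borel rs_site :: real measure"
  note a = rs_site_pos rs_site_less_end
  have r: "\<beta> * (?q - ?a) = \<rho>" using \<beta>_pos by (simp add: rs_end_def)
  interpret order_parameter L d B t \<beta> \<mu> ?q ?Z
  proof
    show "?q > 0" using a by simp
    have "?q \<notin> measure_support ?Z"
      unfolding measure_support_def mem_Collect_eq not_all
      \<comment> \<open>This open half-line contains the endpoint but misses the atom.\<close>
      by (rule exI[of _ "{?a<..}"]) (use a in auto)
    then show "?Z \<in> Y_set ?q"
      using a by (auto simp: Y_set_def measure_return intro: prob_space_return)
    show "\<beta> * integral {0..?q} (\<lambda>u. measure ?Z {0..u}) = \<rho>"
      using delta_return[of 0 ?a ?q] a r by (simp add: delta_def)
  qed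
  have F_a: "F ?a = 0"
    using F_return[OF _ a(2) r] a deriv_K_neg by (simp add: rs_site_def)
  \<comment> \<open>\<open>F\<close> is decreasing and vanishes at the site, so
    \<open>\<phi>\<close> rises before it and falls after it.\<close>
  have max: "\<phi> s \<le> \<phi> ?a" if s: "0 \<le> s" "s < ?q" for s
  proof (cases "s \<le> ?a")
    case True
    show ?thesis
    proof (rule DERIV_nonneg_imp_increasing_open[OF True])
      show "\<exists>y. (\<phi> has_real_derivative y) (at z) \<and> 0 \<le> y" if "s < z" "z < ?a" for z
        using \<phi>_deriv[of z] F_antimono[of z ?a] F_a that a s by (intro exI[of _ "F z"]) auto
      show "continuous_on {s..?a} \<phi>" using s a by (intro continuous_on_subset[OF \<phi>_cont]) auto
    qed
  next
    case False
    then have "?a \<le> s" by simp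
    then show ?thesis
    proof (rule DERIV_nonpos_imp_decreasing_open)
      show "\<exists>y. (\<phi> has_real_derivative y) (at z) \<and> y \<le> 0" if "?a < z" "z < s" for z
        using \<phi>_deriv[of z] F_antimono[of ?a z] F_a that a s by (intro exI[of _ "F z"]) auto
      show "continuous_on {?a..s} \<phi>" using s a by (intro continuous_on_subset[OF \<phi>_cont]) auto
    qed
  qed
  have sup: "(SUP s'\<in>{0<..<?q}. f s') = ereal (\<phi> ?a)"
  proof (rule antisym)
    show "(SUP s'\<in>{0<..<?q}. f s') \<le> ereal (\<phi> ?a)"
      using max by (intro SUP_least) (simp add: f_eq)
    have "f ?a \<le> (SUP s'\<in>{0<..<?q}. f s')" using a by (intro SUP_upper) auto
    then show "ereal (\<phi> ?a) \<le> (SUP s'\<in>{0<..<?q}. f s')" using a by (simp add: f_eq)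
  qed
  have S: "{s \<in> {0..?q}. f s = (SUP s'\<in>{0<..<?q}. f s')} = {s \<in> {0..<?q}. \<phi> s = \<phi> ?a}" (is "?S = ?S'")
    unfolding sup by (auto simp: f_fun_def split: if_splits)
  \<comment> \<open>\<open>measure_return\<close> requires a measurable set; the maximizers form a
    relatively closed subset of a half-open interval.\<close>
  have "closedin (top_of_set {0..<?q}) ?S'"
    by (rule continuous_closedin_preimage_constant[OF \<phi>_cont])
  then obtain T where "closed T" "?S' = {0..<?q} \<inter> T" by (auto simp: closedin_closed)
  then have "?S' \<in> sets borel" by simp
  then have "measure ?Z ?S' = indicator ?S' ?a" by (rule measure_return)
  also have "\<dots> = 1" using a by (intro indicator_eq_1_iff[THEN iffD2]) auto
  finally have "measure ?Z ?S = 1" unfolding S .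
  then show ?thesis
    using q_pos zeta constraint unfolding parisi_pair_def by blast
qed

lemma replica_symmetric: "replica_symmetric L d B t \<beta> \<mu>"
proof -
  have "(THE p. parisi_pair L d B t \<beta> \<mu> p) = (rs_end, return borel rs_site)"
  proof (rule the_equality)
    show "parisi_pair L d B t \<beta> \<mu> (rs_end, return borel rs_site)" by (rule parisi_pair_rs)
    fix p assume "parisi_pair L d B t \<beta> \<mu> p"
    then show "p = (rs_end, return borel rs_site)"
      using parisi_pair_unique[of "fst p" "snd p"] by (metis prod.collapse)
  qed
  then have "parisi_measure L d B t \<beta> \<mu> = return borel rs_site"
    unfolding parisi_measure_def by simp
  then show ?thesis unfolding replica_symmetric_def by blast
qed

end

subsection \<open>The Larkin equation\<close>

text \<open>\<open>GREATEST\<close> has its intended value only if a largest solution exists. The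
  solutions from \<open>w\<close> on form a nonempty compact subset of \<open>{w..V}\<close>, so the
  maximum is attained.\<close>

lemma greatest_solution:
  fixes g :: "real \<Rightarrow> real"
  assumes cont: "\<And>v. v > 0 \<Longrightarrow> isCont g v"
    and small: "\<And>v. v \<ge> V \<Longrightarrow> g v < 1"
    and w: "w > 0" "g w = 1"
  shows "w \<le> (GREATEST v. v > 0 \<and> g v = 1)"
proof -
  let ?T = "{v \<in> {w..V}. g v = 1}"
  have "closed ?T"
    using cont w(1) by (intro continuous_closed_preimage_constant continuous_at_imp_continuous_on) auto
  moreover have "bounded ?T"
    by (rule bounded_subset[OF bounded_closed_interval[of w V]]) auto
  ultimately have "compact ?T" by (simp only: compact_eq_bounded_closed)
  moreover have "w \<le> V" using small[of w] w(2) by linarith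
  then have "?T \<noteq> {}" using w by auto
  ultimately obtain m where m: "m \<in> ?T" "\<And>v. v \<in> ?T \<Longrightarrow> v \<le> m"
    using compact_attains_sup[of ?T] by auto
  have "(GREATEST v. v > 0 \<and> g v = 1) = m"
  proof (rule Greatest_equality)
    show "0 < m \<and> g m = 1" using m(1) w(1) by auto
    show "v \<le> m" if v: "0 < v \<and> g v = 1" for v
    proof (cases "w \<le> v")
      case True
      have "v \<le> V" using small[of v] v by linarith
      then show ?thesis using m(2)[of v] True v by simp
    qed (use m(1) in simp)
  qed
  then show ?thesis using m(1) by simp
qed

locale elastic_manifold = torus L d t for L d :: nat and t :: real +
  fixes B :: "real \<Rightarrow> real" and C :: real
  assumes deriv_B: "\<And>y. y > 0 \<Longrightarrow> (deriv B has_real_derivative deriv (deriv B) y) (at y)"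
    and deriv_B_neg: "\<And>y. y > 0 \<Longrightarrow> deriv B y < 0"
    and deriv2_B_cont: "\<And>y. y > 0 \<Longrightarrow> isCont (deriv (deriv B)) y"
    and deriv2_B_pos: "\<And>y. y > 0 \<Longrightarrow> 0 < deriv (deriv B) y"
    and deriv2_B_le: "\<And>y. y > 0 \<Longrightarrow> deriv (deriv B) y \<le> C"
    and deriv2_B_decreasing: "\<And>x y. 0 < x \<Longrightarrow> x < y \<Longrightarrow> deriv (deriv B) y < deriv (deriv B) x"
begin

definition larkin_fun :: "real \<Rightarrow> real \<Rightarrow> real" where
  "larkin_fun \<beta> v = 4 * deriv (deriv B) (2 / \<beta> * R1 v) * R2 v"

lemma larkin_eq_iff: "larkin_eq L d B t \<beta> v \<longleftrightarrow> larkin_fun \<beta> v = 1"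
  by (simp add: larkin_eq_def larkin_fun_def)

lemma isCont_larkin_fun:
  assumes "\<beta> > 0" "v > 0"
  shows "isCont (larkin_fun \<beta>) v" "isCont (\<lambda>b. larkin_fun b v) \<beta>"
proof -
  have pos: "2 / \<beta> * R1 v > 0" using assms R1_pos by simp
  have "isCont (\<lambda>v. 2 / \<beta> * R1 v) v" using isCont_R1[OF assms(2)] by (intro continuous_intros)
  then have "isCont (\<lambda>v. deriv (deriv B) (2 / \<beta> * R1 v)) v"
    using deriv2_B_cont[OF pos] by (rule isCont_o2)
  then show "isCont (larkin_fun \<beta>) v"
    unfolding larkin_fun_def using isCont_R2[OF assms(2)] by (intro continuous_intros)
  have "isCont (\<lambda>b. 2 / b * R1 v) \<beta>" using assms(1) by (intro continuous_intros) auto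
  then have "isCont (\<lambda>b. deriv (deriv B) (2 / b * R1 v)) \<beta>"
    using deriv2_B_cont[OF pos] by (rule isCont_o2)
  then show "isCont (\<lambda>b. larkin_fun b v) \<beta>"
    unfolding larkin_fun_def by (intro continuous_intros)
qed

text \<open>The second derivative of \<open>B\<close> is bounded by \<open>C\<close>, while
  \<open>R2\<close> tends to 0.\<close>

lemma larkin_fun_small:
  assumes "\<beta> > 0"
  obtains V where "\<And>v. v \<ge> V \<Longrightarrow> larkin_fun \<beta> v < 1"
proof -
  have "((\<lambda>v. 4 * C * R2 v) \<longlongrightarrow> 4 * C * 0) at_top"
    by (intro tendsto_intros R2_tendsto_0)
  then have "\<forall>\<^sub>F v in at_top. 4 * C * R2 v < 1"
    by (rule order_tendstoD) simp
  then have "\<forall>\<^sub>F v in at_top. larkin_fun \<beta> v < 1"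
    using eventually_gt_at_top[of 0]
  proof eventually_elim
    case (elim v)
    have "larkin_fun \<beta> v \<le> 4 * C * R2 v"
      unfolding larkin_fun_def using assms elim(2) R1_pos[of v] R2_pos[of v]
      by (intro mult_right_mono mult_left_mono deriv2_B_le) auto
    with elim(1) show ?case by simp
  qed
  then show thesis using that by (auto simp: eventually_at_top_linorder)
qed

text \<open>A value above 1 must come back down to 1 further right, because the function is
  eventually below 1.\<close>

lemma larkin_solution:
  assumes "\<beta> > 0" "w > 0" "larkin_fun \<beta> w > 1"
  obtains v where "v > w" "larkin_fun \<beta> v = 1"
proof -
  from larkin_fun_small[OF assms(1)] obtain V where V: "\<And>v. v \<ge> V \<Longrightarrow> larkin_fun \<beta> v < 1" by blast
  define u where "u = max w V"
  have "larkin_fun \<beta> u \<le> 1" "w \<le> u" using V[of u] by (auto simp: u_def)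
  then obtain v where "w \<le> v" "larkin_fun \<beta> v = 1"
    using IVT2[of "larkin_fun \<beta>" u 1 w] assms isCont_larkin_fun(1) by auto
  then show thesis using that[of v] assms(3) by (cases "v = w") auto
qed

lemma replica_symmetric_if_larkin_le:
  assumes "\<beta> > 0" "\<mu> > 0" and le: "\<And>v. v \<ge> \<mu> \<Longrightarrow> larkin_fun \<beta> v \<le> 1"
  shows "replica_symmetric L d B t \<beta> \<mu>"
proof -
  interpret stable_model L d B t \<beta> \<mu>
  proof
    show "R1 \<mu> > 0" by (rule R1_pos[OF assms(2)])
    show "continuous_on {0<..R1 \<mu>} (deriv K)" by (rule continuous_deriv_K[OF assms(2)])
    show "deriv K (R1 \<mu>) < 0" using deriv_K[OF assms(2)] R2_pos[OF assms(2)] by simp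
    show "4 * deriv (deriv B) (2 * y / \<beta>) + deriv K y \<le> 0" if y: "0 < y" "y \<le> R1 \<mu>" for y
    proof -
      \<comment> \<open>Writing \<open>y = R1 v\<close> with \<open>v \<ge> \<mu>\<close> and
        dividing the Larkin bound at \<open>v\<close> by \<open>R2 v\<close> gives
        stability.\<close>
      from R1_preimage[OF assms(2) y] obtain v where v: "v \<ge> \<mu>" "R1 v = y" .
      have "v > 0" using v(1) assms(2) by simp
      have "4 * deriv (deriv B) (2 * y / \<beta>) \<le> 1 / R2 v"
        using le[OF v(1)] R2_pos[OF \<open>v > 0\<close>] unfolding larkin_fun_def v(2)
        by (simp add: pos_le_divide_eq)
      moreover have "deriv K y = - 1 / R2 v" using deriv_K[OF \<open>v > 0\<close>] unfolding v(2) .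
      ultimately show ?thesis by simp
    qed
  qed (use assms deriv_B deriv_B_neg deriv2_B_decreasing in auto)
  show ?thesis by (rule replica_symmetric)
qed

text \<open>A value above 1 persists, by continuity in the inverse temperature, at some
  \<open>b < \<beta>\<close>. There the Larkin equation has a solution, so \<open>beta_DW\<close> is
  at most \<open>b\<close>; stepping to the left also settles the case of equality.\<close>

lemma larkin_le_if_below_beta_DW:
  assumes "\<beta> > 0" "\<beta> \<le> beta_DW L d B t" "v > 0"
  shows "larkin_fun \<beta> v \<le> 1"
proof (rule ccontr)
  assume "\<not> ?thesis"
  then have "larkin_fun \<beta> v > 1" by simp
  moreover have "((\<lambda>b. larkin_fun b v) \<longlongrightarrow> larkin_fun \<beta> v) (at_left \<beta>)"
    using isCont_larkin_fun(2)[OF assms(1,3)] unfolding isCont_def by (rule tendsto_within_subset) simp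
  ultimately have "\<forall>\<^sub>F b in at_left \<beta>. larkin_fun b v > 1" by (intro order_tendstoD)
  moreover have "\<forall>\<^sub>F b in at_left \<beta>. b \<in> {0<..<\<beta>}"
    using assms(1) by (intro eventually_at_leftI[of 0]) auto
  ultimately have "\<forall>\<^sub>F b in at_left \<beta>. larkin_fun b v > 1 \<and> b \<in> {0<..<\<beta>}"
    by (rule eventually_conj)
  then obtain b where b: "larkin_fun b v > 1" "0 < b" "b < \<beta>"
    using eventually_happens'[OF trivial_limit_at_left_real] by fastforce
  from larkin_solution[OF b(2) assms(3) b(1)] obtain w where "w > v" "larkin_fun b w = 1" .
  then have "beta_DW L d B t \<le> b"
    unfolding beta_DW_def larkin_eq_iff using b(2) assms(3)
    by (intro cInf_lower bdd_belowI[of _ 0]) (auto intro!: exI[of _ w])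
  then show False using assms(2) b(3) by simp
qed

text \<open>A value above 1 at \<open>v\<close> would produce a solution beyond \<open>v\<close>,
  hence beyond the largest solution \<open>mu_Lar\<close>.\<close>

lemma larkin_le_if_above_mu_Lar:
  assumes "\<beta> > 0" "\<mu> > 0" "mu_Lar L d B t \<beta> \<le> \<mu>" "\<mu> \<le> v"
  shows "larkin_fun \<beta> v \<le> 1"
proof (rule ccontr)
  assume "\<not> ?thesis"
  then have "larkin_fun \<beta> v > 1" by simp
  moreover have "v > 0" using assms by simp
  ultimately obtain w where w: "w > v" "larkin_fun \<beta> w = 1"
    using larkin_solution assms(1) by blast
  from larkin_fun_small[OF assms(1)] obtain V where V: "\<And>v. v \<ge> V \<Longrightarrow> larkin_fun \<beta> v < 1" by blast
  have "w \<le> mu_Lar L d B t \<beta>"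
    unfolding mu_Lar_def larkin_eq_iff using w \<open>v > 0\<close>
    by (intro greatest_solution[OF isCont_larkin_fun(1)[OF assms(1)] V]) auto
  then show False using w(1) assms by simp
qed

end

theorem theorem1p11:
  fixes L d :: nat and t \<beta> \<mu> :: real and B :: "real \<Rightarrow> real"
  assumes "L \<ge> 1" and "t > 0" and "correlator B" and "\<beta> > 0" and "\<mu> > 0"
  shows "(\<beta> \<le> beta_DW L d B t \<longrightarrow> replica_symmetric L d B t \<beta> \<mu>) \<and>
         (\<beta> > beta_DW L d B t \<and> \<mu> \<ge> mu_Lar L d B t \<beta> \<longrightarrow> replica_symmetric L d B t \<beta> \<mu>)"
proof -
  obtain C where C:
    "\<And>y. y > 0 \<Longrightarrow> (deriv B has_real_derivative deriv (deriv B) y) (at y)"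
    "\<And>y. y > 0 \<Longrightarrow> deriv B y < 0"
    "\<And>y. y > 0 \<Longrightarrow> isCont (deriv (deriv B)) y"
    "\<And>y. y > 0 \<Longrightarrow> 0 < deriv (deriv B) y \<and> deriv (deriv B) y \<le> C"
    "\<And>x y. 0 < x \<Longrightarrow> x < y \<Longrightarrow> deriv (deriv B) y < deriv (deriv B) x"
    using correlator_deriv_props[OF assms(3)] by blast
  interpret elastic_manifold L d t B C
    by unfold_locales (use C assms in auto)
  show ?thesis
    using replica_symmetric_if_larkin_le[OF assms(4,5)] larkin_le_if_below_beta_DW[OF assms(4)]
      larkin_le_if_above_mu_Lar[OF assms(4,5)] assms(5) by force
qed

end
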